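(* Let $p,q\ge1$ be such that $\frac1p+\frac1q>1$. Let $(\pi^n)_{n\in\mathbb{N}}$ be a sequence of partitions and let $S\in\mathcal{L}_{c,p}(\pi^n)$, with continuous local time $L_t(u)=L_t(S,u)$ along $(\pi^n)$. Let $f\colon\mathbb{R}\to\mathbb{R}$ be absolutely continuous with right-continuous Radon-Nikodym derivative $f'$ of locally finite $q$-variation. Then for all $t\in[0,\infty)$ the generalized change of variable formula $$f(S(t))=f(S(0))+\int_0^t f'(S(s))\,\mathrm{d}S(s)+\int_{-\infty}^{\infty}L_t(u)\,\mathrm{d}f'(u)$$ holds, where $\mathrm{d}f'(u)$ denotes Young integration and where $$\int_0^t f'(S(s))\,\mathrm{d}S(s):=\lim_{n\to\infty}\sum_{t_j\in\pi^n}f'(S(t_j))\,\bigl(S(t_{j+1}\wedge t)-S(t_j\wedge t)\bigr),\qquad t\in[0,\infty)$$ (in particular this limit exists). In particular, the integral $\int_0^{\cdot}g(S(s))\,\mathrm{d}S(s)$, defined as the limit of the same Riemann sums with $g$ in place of $f'$, is defined for all right-continuous $g\colon\mathbb{R}\to\mathbb{R}$ of locally finite $q$-variation, and for all $T>0$ the map $\mathcal{V}^q\ni g\mapsto\int_0^{\cdot}g(S(s))\,\mathrm{d}S(s)\in C([0,T],\mathbb{R})$ defines a bounded linear operator.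
   Context: Partitions: a partition $\pi$ is an increasing sequence $0=t_0<t_1<\dots$ without accumulation points in $[0,\infty)$, possibly taking the value $\infty$ (in which case it stops there). In sums over $t_j\in\pi$, $t_j$ ranges over the finite elements and $t_{j+1}$ is the successor of $t_j$ in $\pi$ (possibly $\infty$); for fixed $t$ only finitely many terms are nonzero. For $T>0$ put $\pi[0,T]:=\{t_j: t_j\in[0,T)\}\cup\{T\}$, and for continuous $S\colon[0,\infty)\to\mathbb{R}$ let $m(S,\pi[0,T])$ be the maximum of $|S(s_j)-S(s_{j-1})|$ over consecutive elements $s_{j-1}<s_j$ of $\pi[0,T]$. Discrete local time: for real $a,b$ let $J(a,b):=(a,b]$ if $a\le b$ and $J(a,b):=(b,a]$ if $a>b$. For a partition $\pi$, $t\ge0$, $u\in\mathbb{R}$, $$L^{\pi}_t(S,u):=\sum_{t_j\in\pi}\mathbf{1}_{J(S(t_j\wedge t),\,S(t_{j+1}\wedge t))}(u)\,|S(t_{j+1}\wedge t)-u|.$$ $L^2$-local time: a function $L(S)\colon[0,\infty)\times\mathbb{R}\to\mathbb{R}$ is an $L^2$-local time of $S\in C([0,\infty),\mathbb{R})$ along $(\pi^n)$ if for all $t\in[0,\infty)$ one has $\lim_{n\to\infty}m(S,\pi^n[0,t])=0$ and $L^{\pi^n}_t(S,\cdot)$ converges weakly in $L^2(\mathrm{d}u)$ to $L_t(S,\cdot)$. $\mathcal{L}_{L^2}(\pi^n)$ is the set of continuous functions having an $L^2$-local time along $(\pi^n)$. Continuous local time: $S\in\mathcal{L}_{L^2}(\pi^n)$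 has a continuous local time along $(\pi^n)$ if for all $t\in[0,\infty)$ the functions $L^{\pi^n}_t(S,\cdot)$ converge uniformly on $\mathbb{R}$ to a continuous limit $L_t(S,\cdot)$ as $n\to\infty$ and $(t,u)\mapsto L_t(S,u)$ is jointly continuous. $\mathcal{L}_c(\pi^n)$ is the set of all such $S$; one writes $L_t(u)=L_t(S,u)$. $p$-variation: for $h\colon\mathbb{R}\to\mathbb{R}$, $$\|h\|_{p\text{-var}}:=\sup\Bigl\{\Bigl(\sum_{k=1}^m|h(u_k)-h(u_{k-1})|^p\Bigr)^{1/p}: -\infty<u_0<\dots<u_m<\infty,\ m\in\mathbb{N}\Bigr\};$$ locally finite $q$-variation means finite $q$-variation on every compact interval. $\mathcal{V}^q$ is the space of right-continuous functions $\mathbb{R}\to\mathbb{R}$ of finite $q$-variation (and finite norm), equipped with the maximum of the $q$-variation seminorm and the supremum norm. $C([0,T],\mathbb{R})$ carries the supremum norm. $\mathcal{L}_{c,p}(\pi^n)$ is the set of $S\in\mathcal{L}_c(\pi^n)$ such that $\sup_{n\in\mathbb{N}}\sup_{t\in[0,T]}\|L^{\pi^n}_t(S,\cdot)\|_{p\text{-var}}<\infty$ for all $T>0$. Young integral: if $h,g$ on a compact interval $[a,b]$ have finite $p$- and $q$-variation respectively with $1/p+1/q>1$ and have no common points of discontinuity, then the Riemann sums $\sum_j h(u_j)(g(u_{j+1})-g(u_j))$ converge to the same limit along any sequence of partitions of $[a,b]$ with mesh size going to zero; this limit is the Young integral $\int_a^b h\,\mathrm{d}g$. Since $L_t(\cdot)$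 is compactly supported, $\int_{-\infty}^\infty L_t(u)\,\mathrm{d}f'(u)$ is the Young integral over any compact interval whose interior contains the support of $L_t$. *)

theory Defs
  imports "HOL-Analysis.Analysis"
begin

text \<open>
  A partition is encoded as a sequence of extended reals. A partition that reaches \<open>\<infinity>\<close>
  (and stops there) is padded with \<open>\<infinity>\<close>; sums over the partition only
  range over the indices of its finite elements.
\<close>

definition time_partition :: "(nat \<Rightarrow> ereal) \<Rightarrow> bool" where
  "time_partition \<tau> \<longleftrightarrow>
     \<tau> 0 = 0 \<and>
     (\<forall>j. \<tau> j < \<infinity> \<longrightarrow> \<tau> j < \<tau> (Suc j)) \<and>
     (\<forall>j. \<tau> j = \<infinity> \<longrightarrow> \<tau> (Suc j) = \<infinity>) \<and>
     (\<forall>x::real. x \<ge> 0 \<longrightarrow> \<not> x islimpt {s. ereal s \<in> range \<tau>})"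

definition min_time :: "ereal \<Rightarrow> real \<Rightarrow> real" where
  "min_time s t = real_of_ereal (min s (ereal t))"

definition partition_upto :: "(nat \<Rightarrow> ereal) \<Rightarrow> real \<Rightarrow> real set" where
  "partition_upto \<tau> T = {s. ereal s \<in> range \<tau> \<and> 0 \<le> s \<and> s < T} \<union> {T}"

text \<open>
  The value \<open>0\<close> is inserted only so that the maximum is \<open>0\<close> when there are no consecutive
  elements, which happens for the one-point set obtained at \<open>T = 0\<close>.
\<close>

definition max_oscillation :: "(real \<Rightarrow> real) \<Rightarrow> real set \<Rightarrow> real" where
  "max_oscillation S A =
     Max (insert 0 {\<bar>S s' - S s\<bar> | s s'. s \<in> A \<and> s' \<in> A \<and> s < s' \<and> A \<inter> {s<..<s'} = {}})"

definition half_open :: "real \<Rightarrow> real \<Rightarrow> real set" where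
  "half_open a b = (if a \<le> b then {a<..b} else {b<..a})"

definition discrete_local_time ::
    "(nat \<Rightarrow> ereal) \<Rightarrow> (real \<Rightarrow> real) \<Rightarrow> real \<Rightarrow> real \<Rightarrow> real" where
  "discrete_local_time \<tau> S t u =
     (\<Sum>\<^sub>\<infinity>j\<in>{j. \<tau> j < \<infinity>}.
        indicator (half_open (S (min_time (\<tau> j) t)) (S (min_time (\<tau> (Suc j)) t))) u
        * \<bar>S (min_time (\<tau> (Suc j)) t) - u\<bar>)"

definition L2 :: "(real \<Rightarrow> real) set" where
  "L2 = {h \<in> borel_measurable lebesgue. integrable lebesgue (\<lambda>u. (h u)\<^sup>2)}"

definition weakly_converges_L2 :: "(nat \<Rightarrow> real \<Rightarrow> real) \<Rightarrow> (real \<Rightarrow> real) \<Rightarrow> bool" where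
  "weakly_converges_L2 h l \<longleftrightarrow>
     (\<forall>n. h n \<in> L2) \<and> l \<in> L2 \<and>
     (\<forall>g\<in>L2. (\<lambda>n. LINT u|lebesgue. h n u * g u) \<longlonglongrightarrow> (LINT u|lebesgue. l u * g u))"

text \<open>
  Paths \<open>S\<close> on \<open>[0, \<infinity>)\<close> and functions \<open>L\<close> on
  \<open>[0, \<infinity>) \<times> \<real>\<close> are total functions whose values at negative times are irrelevant.
\<close>

definition L2_local_time ::
    "(nat \<Rightarrow> nat \<Rightarrow> ereal) \<Rightarrow> (real \<Rightarrow> real) \<Rightarrow> (real \<Rightarrow> real \<Rightarrow> real) \<Rightarrow> bool" where
  "L2_local_time \<pi> S L \<longleftrightarrow>
     (\<forall>t\<ge>0. (\<lambda>n. max_oscillation S (partition_upto (\<pi> n) t)) \<longlonglongrightarrow> 0 \<and>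
            weakly_converges_L2 (\<lambda>n. discrete_local_time (\<pi> n) S t) (L t))"

definition paths_L2 :: "(nat \<Rightarrow> nat \<Rightarrow> ereal) \<Rightarrow> (real \<Rightarrow> real) set" where
  "paths_L2 \<pi> = {S. continuous_on {0..} S \<and> (\<exists>L. L2_local_time \<pi> S L)}"

definition continuous_local_time ::
    "(nat \<Rightarrow> nat \<Rightarrow> ereal) \<Rightarrow> (real \<Rightarrow> real) \<Rightarrow> (real \<Rightarrow> real \<Rightarrow> real) \<Rightarrow> bool" where
  "continuous_local_time \<pi> S L \<longleftrightarrow>
     (\<forall>t\<ge>0. uniform_limit UNIV (\<lambda>n. discrete_local_time (\<pi> n) S t) (L t) sequentially \<and>
            continuous_on UNIV (L t)) \<and>
     continuous_on ({0..} \<times> UNIV) (\<lambda>(t, u). L t u)"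

definition paths_c :: "(nat \<Rightarrow> nat \<Rightarrow> ereal) \<Rightarrow> (real \<Rightarrow> real) set" where
  "paths_c \<pi> = {S \<in> paths_L2 \<pi>. \<exists>L. continuous_local_time \<pi> S L}"

definition p_variation_on :: "real set \<Rightarrow> real \<Rightarrow> (real \<Rightarrow> real) \<Rightarrow> ennreal" where
  "p_variation_on A p h =
     (SUP (m, u) \<in> {(m::nat, u). strict_mono_on {..m} u \<and> u ` {..m} \<subseteq> A}.
        ennreal ((\<Sum>k=1..m. \<bar>h (u k) - h (u (k - 1))\<bar> powr p) powr (1 / p)))"

definition locally_finite_variation :: "real \<Rightarrow> (real \<Rightarrow> real) \<Rightarrow> bool" where
  "locally_finite_variation q g \<longleftrightarrow> (\<forall>a b. p_variation_on {a..b} q g < \<infinity>)"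

definition paths_cp :: "real \<Rightarrow> (nat \<Rightarrow> nat \<Rightarrow> ereal) \<Rightarrow> (real \<Rightarrow> real) set" where
  "paths_cp p \<pi> =
     {S \<in> paths_c \<pi>. \<forall>T>0.
        (SUP n. SUP t\<in>{0..T}. p_variation_on UNIV p (discrete_local_time (\<pi> n) S t)) < \<infinity>}"

definition right_continuous :: "(real \<Rightarrow> real) \<Rightarrow> bool" where
  "right_continuous g \<longleftrightarrow> (\<forall>x. continuous (at_right x) g)"

definition absolutely_continuous_on :: "real \<Rightarrow> real \<Rightarrow> (real \<Rightarrow> real) \<Rightarrow> bool" where
  "absolutely_continuous_on a b f \<longleftrightarrow>
     (\<forall>\<epsilon>>0. \<exists>\<delta>>0. \<forall>d s. d division_of s \<and> s \<subseteq> {a..b} \<and> (\<Sum>k\<in>d. Sup k - Inf k) < \<delta>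
        \<longrightarrow> (\<Sum>k\<in>d. \<bar>f (Sup k) - f (Inf k)\<bar>) < \<epsilon>)"

text \<open>
  Absolute continuity on the real line is understood on compact intervals. The function \<open>f'\<close>
  is a density, with respect to Lebesgue measure, of the (locally finite, signed) measure
  \<open>(a, b] \<mapsto> f b - f a\<close>.
\<close>

definition absolutely_continuous_with_density ::
    "(real \<Rightarrow> real) \<Rightarrow> (real \<Rightarrow> real) \<Rightarrow> bool" where
  "absolutely_continuous_with_density f f' \<longleftrightarrow>
     (\<forall>a b. a \<le> b \<longrightarrow>
        absolutely_continuous_on a b f \<and>
        set_integrable lborel {a<..b} f' \<and>
        f b - f a = (LINT u:{a<..b}|lborel. f' u))"

definition partition_of_interval :: "real \<Rightarrow> real \<Rightarrow> nat \<Rightarrow> (nat \<Rightarrow> real) \<Rightarrow> bool" where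
  "partition_of_interval a b m u \<longleftrightarrow> strict_mono_on {..m} u \<and> u 0 = a \<and> u m = b"

definition mesh :: "nat \<Rightarrow> (nat \<Rightarrow> real) \<Rightarrow> real" where
  "mesh m u = Max ((\<lambda>j. u (Suc j) - u j) ` {..<m})"

definition has_young_integral ::
    "real \<Rightarrow> real \<Rightarrow> (real \<Rightarrow> real) \<Rightarrow> (real \<Rightarrow> real) \<Rightarrow> real \<Rightarrow> real \<Rightarrow> real \<Rightarrow> bool" where
  "has_young_integral p q h g a b I \<longleftrightarrow>
     a < b \<and>
     p_variation_on {a..b} p h < \<infinity> \<and> p_variation_on {a..b} q g < \<infinity> \<and>
     (\<forall>x\<in>{a..b}. continuous (at x within {a..b}) h \<or> continuous (at x within {a..b}) g) \<and>
     (\<forall>m u. (\<forall>n. partition_of_interval a b (m n) (u n)) \<and>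
            (\<lambda>n. mesh (m n) (u n)) \<longlonglongrightarrow> 0 \<longrightarrow>
        (\<lambda>n. \<Sum>j<m n. h (u n j) * (g (u n (Suc j)) - g (u n j))) \<longlonglongrightarrow> I)"

text \<open>
  The first conjunct says that \<open>h\<close> has compact support, so that the second one is not vacuous.
\<close>

definition has_young_integral_line ::
    "real \<Rightarrow> real \<Rightarrow> (real \<Rightarrow> real) \<Rightarrow> (real \<Rightarrow> real) \<Rightarrow> real \<Rightarrow> bool" where
  "has_young_integral_line p q h g I \<longleftrightarrow>
     compact (closure {u. h u \<noteq> 0}) \<and>
     (\<forall>a b. a < b \<and> closure {u. h u \<noteq> 0} \<subseteq> {a<..<b} \<longrightarrow> has_young_integral p q h g a b I)"

definition riemann_sum ::
    "(nat \<Rightarrow> ereal) \<Rightarrow> (real \<Rightarrow> real) \<Rightarrow> (real \<Rightarrow> real) \<Rightarrow> real \<Rightarrow> real" where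
  "riemann_sum \<tau> S g t =
     (\<Sum>\<^sub>\<infinity>j\<in>{j. \<tau> j < \<infinity>}.
        g (S (real_of_ereal (\<tau> j))) * (S (min_time (\<tau> (Suc j)) t) - S (min_time (\<tau> j) t)))"

definition path_integral ::
    "(nat \<Rightarrow> nat \<Rightarrow> ereal) \<Rightarrow> (real \<Rightarrow> real) \<Rightarrow> (real \<Rightarrow> real) \<Rightarrow> real \<Rightarrow> real" where
  "path_integral \<pi> S g t = lim (\<lambda>n. riemann_sum (\<pi> n) S g t)"

definition sup_norm_on :: "real set \<Rightarrow> (real \<Rightarrow> real) \<Rightarrow> ennreal" where
  "sup_norm_on A h = (SUP x\<in>A. ennreal \<bar>h x\<bar>)"

definition V_norm :: "real \<Rightarrow> (real \<Rightarrow> real) \<Rightarrow> ennreal" where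
  "V_norm q g = max (p_variation_on UNIV q g) (sup_norm_on UNIV g)"

definition V_space :: "real \<Rightarrow> (real \<Rightarrow> real) set" where
  "V_space q = {g. right_continuous g \<and> V_norm q g < \<infinity>}"

text \<open>
  Elements of \<open>C([0,T], \<real>)\<close> are represented by functions continuous on \<open>{0..T}\<close>, and two of
  them are identified if they agree there; hence linearity is required at the points of
  \<open>{0..T}\<close>.
\<close>

definition bounded_linear_V_C ::
    "real \<Rightarrow> real \<Rightarrow> ((real \<Rightarrow> real) \<Rightarrow> real \<Rightarrow> real) \<Rightarrow> bool" where
  "bounded_linear_V_C q T \<Phi> \<longleftrightarrow>
     (\<forall>g\<in>V_space q. continuous_on {0..T} (\<Phi> g)) \<and>
     (\<forall>g\<in>V_space q. \<forall>h\<in>V_space q. \<forall>t\<in>{0..T}. \<Phi> (\<lambda>u. g u + h u) t = \<Phi> g t + \<Phi> h t) \<and>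
     (\<forall>c. \<forall>g\<in>V_space q. \<forall>t\<in>{0..T}. \<Phi> (\<lambda>u. c * g u) t = c * \<Phi> g t) \<and>
     (\<exists>C::real. \<forall>g\<in>V_space q. sup_norm_on {0..T} (\<Phi> g) \<le> ennreal C * V_norm q g)"

end

theory Submission
  imports Defs
begin

text \<open>
  The formula rests on comparing two limits of the sums
  \<open>\<Sum>\<^sub>j h (u j) (g (u (j + 1)) - g (u j))\<close>, called Young sums below: the limit as the mesh of
  the spatial grid \<open>u\<close> tends to zero, and the limit in which the discrete local times replace their
  limit in the role of \<open>h\<close>.

  For a fixed time partition the discrete local time is a finite sum of ramps
  \<open>v \<mapsto> 1\<^bsub>J(x, y)\<^esub>(v) \<bar>y - v\<bar>\<close>, one for each step of the path from \<open>x\<close> to \<open>y\<close>. Against such a ramp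
  the Young sums can be computed by summation by parts, and, because \<open>g\<close> is right-continuous, they
  converge to \<open>f y - f x - g x (y - x)\<close>, where \<open>f\<close> is the indefinite integral of \<open>g\<close>
  (\<open>young_sum_ramp_tendsto\<close>). Adding up the steps, the Young sums of the discrete local time tend to
  \<open>f (S t) - f (S 0)\<close> minus the Riemann sum (\<open>young_sum_discrete_local_time_tendsto\<close>). This is the
  change of variable formula at the discrete level. The sums converge although a ramp and \<open>g\<close> may jump
  at the same point, because the ramp is left-continuous and \<open>g\<close> is right-continuous.

  The discrete local times converge uniformly, and their \<open>p\<close>-variation is bounded. The inequality of
  Young and Loeve (\<open>young_sum_bound\<close>), applied with an exponent slightly larger than \<open>p\<close> for which
  boundedness and uniform convergence together force convergence in variation, shows that replacing the
  discrete local time by its limit changes every Young sum, on every grid, by an amount that tends to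
  zero (\<open>young_sum_small\<close>). Hence the two limits may be interchanged
  (\<open>local_time_formula_bounded_range\<close>): the Riemann sums converge, the Young integral of the local time
  exists, and the two are related by the formula.

  The same estimates give the statement on operators: the path integral equals
  \<open>f (S t) - f (S 0)\<close> minus the Young integral, the first term is Lipschitz in \<open>S\<close> and the second one
  is bounded by the variation norms, and depends continuously on \<open>t\<close> because the local time does so
  uniformly in space.
\<close>

section \<open>Finite variation and Young sums\<close>

text \<open>
  The bound is on the sums of \<open>p\<close>-th powers, not on their \<open>p\<close>-th roots: in this form it passes to
  limits and is interpolated without taking roots. It is a real number, which keeps the
  estimates out of the extended nonnegative reals.
\<close>

definition variation_bounded :: "real set \<Rightarrow> real \<Rightarrow> (real \<Rightarrow> real) \<Rightarrow> real \<Rightarrow> bool" where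
  "variation_bounded A p h v \<longleftrightarrow>
     (\<forall>m u. strict_mono_on {..m::nat} u \<and> u ` {..m} \<subseteq> A \<longrightarrow>
        (\<Sum>k=1..m. \<bar>h (u k) - h (u (k - 1))\<bar> powr p) \<le> v)"

definition young_sum :: "(real \<Rightarrow> real) \<Rightarrow> (real \<Rightarrow> real) \<Rightarrow> nat \<Rightarrow> (nat \<Rightarrow> real) \<Rightarrow> real" where
  "young_sum h g m u = (\<Sum>j<m. h (u j) * (g (u (Suc j)) - g (u j)))"

lemma variation_boundedD:
  assumes "variation_bounded A p h v" "strict_mono_on {..m::nat} u" "u ` {..m} \<subseteq> A"
  shows "(\<Sum>k=1..m. \<bar>h (u k) - h (u (k - 1))\<bar> powr p) \<le> v"
  using assms by (auto simp: variation_bounded_def)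

lemma variation_bounded_weaken:
  assumes "variation_bounded A p h v" "v \<le> v'" "B \<subseteq> A"
  shows "variation_bounded B p h v'"
  using assms unfolding variation_bounded_def by (meson order_trans subset_trans)

lemma variation_bounded_if_p_variation:
  assumes "p_variation_on A p h \<le> ennreal c" "0 \<le> c" "1 \<le> p"
  shows "variation_bounded A p h (c powr p)"
  unfolding variation_bounded_def
proof (intro allI impI)
  fix m :: nat and u :: "nat \<Rightarrow> real"
  assume u: "strict_mono_on {..m} u \<and> u ` {..m} \<subseteq> A"
  define s where "s = (\<Sum>k=1..m. \<bar>h (u k) - h (u (k - 1))\<bar> powr p)"
  have "ennreal (s powr (1 / p)) \<le> p_variation_on A p h"
    unfolding p_variation_on_def s_def
    by (rule SUP_upper2[of "(m, u)"]) (use u in auto)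
  then have "ennreal (s powr (1 / p)) \<le> ennreal c"
    using assms(1) by (rule order_trans)
  then have "s powr (1 / p) \<le> c" using assms(2) by simp
  then have "(s powr (1 / p)) powr p \<le> c powr p" using assms(3) by (intro powr_mono2) auto
  moreover have "0 \<le> s" unfolding s_def by (intro sum_nonneg) auto
  ultimately show "(\<Sum>k=1..m. \<bar>h (u k) - h (u (k - 1))\<bar> powr p) \<le> c powr p"
    using assms(3) by (simp add: powr_powr s_def)
qed

lemma p_variation_if_variation_bounded:
  assumes "variation_bounded A p h v" "1 \<le> p"
  shows "p_variation_on A p h \<le> ennreal (v powr (1 / p))"
  unfolding p_variation_on_def
proof (rule SUP_least)
  fix z :: "nat \<times> (nat \<Rightarrow> real)"
  assume "z \<in> {(m, u). strict_mono_on {..m} u \<and> u ` {..m} \<subseteq> A}"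
  then obtain m u where z: "z = (m, u)" "strict_mono_on {..m} u" "u ` {..m} \<subseteq> A" by auto
  show "(case z of (m, u) \<Rightarrow>
      ennreal ((\<Sum>k=1..m. \<bar>h (u k) - h (u (k - 1))\<bar> powr p) powr (1 / p)))
     \<le> ennreal (v powr (1 / p))"
    unfolding z prod.case using variation_boundedD[OF assms(1) z(2,3)] assms(2)
    by (intro ennreal_leI powr_mono2 sum_nonneg) auto
qed

lemma variation_bounded_of_finite:
  assumes "p_variation_on A p h < \<infinity>" "1 \<le> p"
  obtains v where "0 < v" "variation_bounded A p h v"
proof -
  obtain c where c: "0 \<le> c" "p_variation_on A p h = ennreal c"
    using assms(1) by (cases "p_variation_on A p h") auto
  have "variation_bounded A p h (c powr p)"
    using c assms by (intro variation_bounded_if_p_variation) auto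
  then have "variation_bounded A p h (c powr p + 1)" by (rule variation_bounded_weaken) auto
  moreover have "0 < c powr p + 1" by (simp add: add_nonneg_pos)
  ultimately show ?thesis using that by blast
qed

lemma variation_bounded_limit:
  assumes "\<And>n. variation_bounded A p (h n) v" "\<And>x. (\<lambda>n. h n x) \<longlonglongrightarrow> l x" "1 \<le> p"
  shows "variation_bounded A p l v"
  unfolding variation_bounded_def
proof (intro allI impI)
  fix m :: nat and u :: "nat \<Rightarrow> real"
  assume u: "strict_mono_on {..m} u \<and> u ` {..m} \<subseteq> A"
  have "(\<lambda>n. \<Sum>k=1..m. \<bar>h n (u k) - h n (u (k - 1))\<bar> powr p)
      \<longlonglongrightarrow> (\<Sum>k=1..m. \<bar>l (u k) - l (u (k - 1))\<bar> powr p)"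
    using assms(2,3) by (intro tendsto_intros tendsto_powr') auto
  then show "(\<Sum>k=1..m. \<bar>l (u k) - l (u (k - 1))\<bar> powr p) \<le> v"
    by (rule LIMSEQ_le_const2) (use variation_boundedD[OF assms(1)] u in blast)
qed

text \<open>
  The larger of the two absolute values is at least half of the distance. The resulting constant is not
  the best one, but it only enters through the finiteness of the variation of a difference.
\<close>

lemma powr_abs_diff_le:
  fixes x y :: real
  assumes "1 \<le> p"
  shows "\<bar>x - y\<bar> powr p \<le> 2 powr p * (\<bar>x\<bar> powr p + \<bar>y\<bar> powr p)"
proof -
  have "\<bar>x - y\<bar> powr p \<le> (2 * max \<bar>x\<bar> \<bar>y\<bar>) powr p"
    using assms by (intro powr_mono2) auto
  also have "\<dots> = 2 powr p * (max \<bar>x\<bar> \<bar>y\<bar>) powr p"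
    by (simp add: powr_mult)
  also have "(max \<bar>x\<bar> \<bar>y\<bar>) powr p \<le> \<bar>x\<bar> powr p + \<bar>y\<bar> powr p"
    by (auto simp: max_def)
  finally show ?thesis by simp
qed

lemma variation_bounded_diff:
  assumes "variation_bounded A p h v" "variation_bounded A p k w" "1 \<le> p"
  shows "variation_bounded A p (\<lambda>x. h x - k x) (2 powr p * (v + w))"
  unfolding variation_bounded_def
proof (intro allI impI)
  fix m :: nat and u :: "nat \<Rightarrow> real"
  assume u: "strict_mono_on {..m} u \<and> u ` {..m} \<subseteq> A"
  let ?d = "\<lambda>f j. f (u j) - f (u (j - 1)) :: real"
  have "(\<Sum>j=1..m. \<bar>?d (\<lambda>x. h x - k x) j\<bar> powr p)
      \<le> (\<Sum>j=1..m. 2 powr p * (\<bar>?d h j\<bar> powr p + \<bar>?d k j\<bar> powr p))"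
  proof (rule sum_mono)
    fix j
    have "\<bar>?d (\<lambda>x. h x - k x) j\<bar> = \<bar>?d h j - ?d k j\<bar>" by simp
    then show "\<bar>?d (\<lambda>x. h x - k x) j\<bar> powr p \<le> 2 powr p * (\<bar>?d h j\<bar> powr p + \<bar>?d k j\<bar> powr p)"
      using powr_abs_diff_le[OF assms(3)] by metis
  qed
  also have "\<dots> = 2 powr p * ((\<Sum>j=1..m. \<bar>?d h j\<bar> powr p) + (\<Sum>j=1..m. \<bar>?d k j\<bar> powr p))"
    by (simp only: sum_distrib_left[symmetric] sum.distrib)
  also have "\<dots> \<le> 2 powr p * (v + w)"
    using variation_boundedD[OF assms(1)] variation_boundedD[OF assms(2)] u
    by (intro mult_left_mono add_mono) auto
  finally show "(\<Sum>j=1..m. \<bar>?d (\<lambda>x. h x - k x) j\<bar> powr p) \<le> 2 powr p * (v + w)" .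
qed

text \<open>
  Of the \<open>r\<close> factors of an increment, \<open>r - p\<close> are estimated by the supremum. A function that is
  uniformly small and of bounded \<open>p\<close>-variation is therefore small in \<open>r\<close>-variation for \<open>r > p\<close>.
\<close>

lemma variation_bounded_interpolation:
  assumes "variation_bounded A p h v" "p \<le> r" "\<And>x. x \<in> A \<Longrightarrow> \<bar>h x\<bar> \<le> d" "0 \<le> d"
  shows "variation_bounded A r h ((2 * d) powr (r - p) * v)"
  unfolding variation_bounded_def
proof (intro allI impI)
  fix m :: nat and u :: "nat \<Rightarrow> real"
  assume u: "strict_mono_on {..m} u \<and> u ` {..m} \<subseteq> A"
  let ?d = "\<lambda>j. h (u j) - h (u (j - 1)) :: real"
  have "(\<Sum>j=1..m. \<bar>?d j\<bar> powr r) \<le> (\<Sum>j=1..m. (2 * d) powr (r - p) * \<bar>?d j\<bar> powr p)"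
  proof (rule sum_mono)
    fix j assume j: "j \<in> {1..m}"
    have "\<bar>h (u j)\<bar> \<le> d" "\<bar>h (u (j - 1))\<bar> \<le> d"
      using u j by (intro assms(3); force)+
    then have "\<bar>?d j\<bar> \<le> 2 * d" by simp
    then have "\<bar>?d j\<bar> powr (r - p) * \<bar>?d j\<bar> powr p \<le> (2 * d) powr (r - p) * \<bar>?d j\<bar> powr p"
      using assms(2) by (intro mult_right_mono powr_mono2) auto
    then show "\<bar>?d j\<bar> powr r \<le> (2 * d) powr (r - p) * \<bar>?d j\<bar> powr p"
      by (simp add: powr_add[symmetric])
  qed
  also have "\<dots> = (2 * d) powr (r - p) * (\<Sum>j=1..m. \<bar>?d j\<bar> powr p)"
    by (simp add: sum_distrib_left)
  also have "\<dots> \<le> (2 * d) powr (r - p) * v"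
    using variation_boundedD[OF assms(1)] u by (intro mult_left_mono) auto
  finally show "(\<Sum>j=1..m. \<bar>?d j\<bar> powr r) \<le> (2 * d) powr (r - p) * v" .
qed

lemma young_sum_diff:
  "young_sum (\<lambda>x. h x - k x) g m u = young_sum h g m u - young_sum k g m u"
  by (simp add: young_sum_def sum_subtractf left_diff_distrib)

lemma sum_lessThan_split:
  fixes F :: "nat \<Rightarrow> real"
  shows "(\<Sum>j<i+r. F j) = (\<Sum>j<i. F j) + (\<Sum>j<r. F (i + j))"
  by (induction r) auto

section \<open>The discrete inequality of Young and Loeve\<close>

text \<open>
  The local cost of deleting one interior grid point, on which the proof of the inequality rests.
\<close>

lemma young_sum_remove:
  fixes u :: "nat \<Rightarrow> real"
  assumes "1 \<le> i" "i \<le> m"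
  defines "u' \<equiv> (\<lambda>k. if k < i then u k else u (Suc k))"
  shows "young_sum h g (Suc m) u - young_sum h g m u' =
    (h (u i) - h (u (i - 1))) * (g (u (Suc i)) - g (u i))"
proof -
  define l where "l = i - 1"
  have i: "i = Suc l" using assms(1) by (simp add: l_def)
  define r where "r = m - i"
  have m: "m = Suc l + r" using assms(2) by (simp add: r_def i)
  have 1: "young_sum h g (Suc m) u = (\<Sum>j<l. h (u j) * (g (u (Suc j)) - g (u j)))
      + h (u l) * (g (u i) - g (u l)) + h (u i) * (g (u (Suc i)) - g (u i))
      + (\<Sum>j<r. h (u (Suc (i + j))) * (g (u (Suc (Suc (i + j)))) - g (u (Suc (i + j)))))"
    using sum_lessThan_split[of "\<lambda>j. h (u j) * (g (u (Suc j)) - g (u j))" "Suc (Suc l)" r]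
    by (simp add: young_sum_def m i)
  have 2: "young_sum h g m u' = (\<Sum>j<l. h (u j) * (g (u (Suc j)) - g (u j)))
      + h (u l) * (g (u (Suc i)) - g (u l))
      + (\<Sum>j<r. h (u (Suc (i + j))) * (g (u (Suc (Suc (i + j)))) - g (u (Suc (i + j)))))"
    using sum_lessThan_split[of "\<lambda>j. h (u' j) * (g (u' (Suc j)) - g (u' j))" "Suc l" r]
    by (simp add: young_sum_def m i u'_def)
  show ?thesis unfolding 1 2 by (simp add: i algebra_simps)
qed

text \<open>
  The \<open>p\<close>-th powers of the increments of \<open>h\<close> divided by \<open>v\<close>, and the \<open>q\<close>-th powers of those of \<open>g\<close>
  divided by \<open>w\<close>, have together a sum of at most \<open>2\<close>. So among \<open>m\<close> interior points there is one at
  which both quotients are at most \<open>2 / m\<close>, and deleting it is cheap.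
\<close>

lemma small_increment_product:
  fixes u :: "nat \<Rightarrow> real"
  assumes h: "variation_bounded A p h v" and g: "variation_bounded A q g w"
    and pos: "0 < v" "0 < w" "1 \<le> p" "1 \<le> q"
    and u: "strict_mono_on {..Suc m} u" "u ` {..Suc m} \<subseteq> A" and m: "1 \<le> m"
  obtains i where "1 \<le> i" "i \<le> m"
    "\<bar>(h (u i) - h (u (i - 1))) * (g (u (Suc i)) - g (u i))\<bar>
       \<le> (2 / m) powr (1 / p + 1 / q) * (v powr (1 / p) * w powr (1 / q))"
proof -
  define a where "a = (\<lambda>i. \<bar>h (u i) - h (u (i - 1))\<bar> powr p)"
  define b where "b = (\<lambda>i. \<bar>g (u (Suc i)) - g (u i)\<bar> powr q)"
  have "(\<Sum>i=1..m. a i) \<le> (\<Sum>i=1..Suc m. a i)" by (auto simp: a_def)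
  also have "\<dots> \<le> v" unfolding a_def using h u by (rule variation_boundedD)
  finally have sa: "(\<Sum>i=1..m. a i) \<le> v" .
  have "(\<Sum>i=1..m. b i) = (\<Sum>i=Suc 1..Suc m. \<bar>g (u i) - g (u (i - 1))\<bar> powr q)"
    unfolding sum.shift_bounds_cl_Suc_ivl by (simp add: b_def)
  also have "\<dots> \<le> (\<Sum>i=1..Suc m. \<bar>g (u i) - g (u (i - 1))\<bar> powr q)"
    by (intro sum_mono2) auto
  also have "\<dots> \<le> w" using g u by (rule variation_boundedD)
  finally have sb: "(\<Sum>i=1..m. b i) \<le> w" .
  have "\<exists>i\<in>{1..m}. a i / v + b i / w \<le> 2 / m"
  proof (rule ccontr)
    assume "\<not> ?thesis"
    then have "(\<Sum>i=1..m. 2 / m) < (\<Sum>i=1..m. a i / v + b i / w)"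
      using m by (intro sum_strict_mono) (auto simp: not_le)
    moreover have "(\<Sum>i=1..m. a i / v + b i / w) = (\<Sum>i=1..m. a i) / v + (\<Sum>i=1..m. b i) / w"
      by (simp add: sum.distrib sum_divide_distrib)
    moreover have "(\<Sum>i=1..m. a i) / v \<le> 1" "(\<Sum>i=1..m. b i) / w \<le> 1"
      using sa sb pos by auto
    ultimately show False using m by simp
  qed
  then obtain i where i: "i \<in> {1..m}" and ab: "a i / v + b i / w \<le> 2 / m" by blast
  have "0 \<le> a i / v" "0 \<le> b i / w" using pos by (auto simp: a_def b_def)
  with ab have "a i / v \<le> 2 / m" "b i / w \<le> 2 / m" by linarith+
  then have le: "a i \<le> 2 / m * v" "b i \<le> 2 / m * w"
    using pos by (auto simp: pos_divide_le_eq)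
  have "a i powr (1 / p) \<le> (2 / m * v) powr (1 / p)"
    using le pos by (intro powr_mono2) (auto simp: a_def)
  then have A: "\<bar>h (u i) - h (u (i - 1))\<bar> \<le> (2 / m * v) powr (1 / p)"
    using pos by (simp add: a_def powr_powr)
  have "b i powr (1 / q) \<le> (2 / m * w) powr (1 / q)"
    using le pos by (intro powr_mono2) (auto simp: b_def)
  then have B: "\<bar>g (u (Suc i)) - g (u i)\<bar> \<le> (2 / m * w) powr (1 / q)"
    using pos by (simp add: b_def powr_powr)
  have "\<bar>(h (u i) - h (u (i - 1))) * (g (u (Suc i)) - g (u i))\<bar>
      \<le> (2 / m * v) powr (1 / p) * (2 / m * w) powr (1 / q)"
    unfolding abs_mult using A B by (intro mult_mono) auto
  also have "\<dots> = (2 / m) powr (1 / p + 1 / q) * (v powr (1 / p) * w powr (1 / q))"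
    by (simp only: powr_add powr_mult mult_ac)
  finally show ?thesis using that i by auto
qed

text \<open>
  This is \<open>2 powr \<theta>\<close> times the value of the zeta function at \<open>\<theta>\<close>.
\<close>

definition young_const :: "real \<Rightarrow> real" where
  "young_const \<theta> = (\<Sum>k. (2 / Suc k) powr \<theta>)"

lemma young_const_summable:
  assumes "1 < \<theta>"
  shows "summable (\<lambda>k. (2 / real (Suc k)) powr \<theta>)"
proof -
  have "summable (\<lambda>k. real k powr (- \<theta>))" using assms by (simp add: summable_real_powr_iff)
  then have "summable (\<lambda>k. 2 powr \<theta> * real (Suc k) powr (- \<theta>))"
    by (intro summable_mult) (subst summable_Suc_iff)
  then show ?thesis by (simp add: powr_divide powr_minus_divide)
qed

lemma young_const_nonneg: "1 < \<theta> \<Longrightarrow> 0 \<le> young_const \<theta>"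
  unfolding young_const_def by (intro suminf_nonneg young_const_summable) auto

text \<open>
  The grid points are deleted one by one, always at the cheapest place, until a sum with the single
  summand \<open>h (u 0) (g (u 1) - g (u 0)) = 0\<close> is left. The costs form a convergent series exactly because
  \<open>1 / p + 1 / q > 1\<close>; hence the bound does not depend on the grid.
\<close>

lemma young_sum_bound:
  fixes u :: "nat \<Rightarrow> real"
  assumes h: "variation_bounded A p h v" and g: "variation_bounded A q g w"
    and pos: "0 < v" "0 < w" "1 \<le> p" "1 \<le> q" and \<theta>: "1 < 1 / p + 1 / q"
    and u: "strict_mono_on {..m} u" "u ` {..m} \<subseteq> A" and h0: "h (u 0) = 0"
  shows "\<bar>young_sum h g m u\<bar> \<le> young_const (1 / p + 1 / q) * (v powr (1 / p) * w powr (1 / q))"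
proof -
  define \<theta> where "\<theta> = 1 / p + 1 / q"
  define c where "c = v powr (1 / p) * w powr (1 / q)"
  have "\<bar>young_sum h g m u\<bar> \<le> (\<Sum>k<m-1. (2 / Suc k) powr \<theta>) * c"
    using u h0
  proof (induction m arbitrary: u)
    case 0
    then show ?case by (simp add: young_sum_def)
  next
    case (Suc m)
    show ?case
    proof (cases "m = 0")
      case True
      then show ?thesis using Suc.prems by (simp add: young_sum_def)
    next
      case False
      then obtain i where i: "1 \<le> i" "i \<le> m"
        "\<bar>(h (u i) - h (u (i - 1))) * (g (u (Suc i)) - g (u i))\<bar> \<le> (2 / m) powr \<theta> * c"
        using small_increment_product[OF h g pos Suc.prems(1,2)]
        unfolding \<theta>_def c_def by (metis One_nat_def Suc_leI neq0_conv)
      define u' where "u' = (\<lambda>k. if k < i then u k else u (Suc k))"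
      have "strict_mono_on {..m} u'"
        using Suc.prems(1) i by (auto simp: u'_def strict_mono_on_def)
      moreover have "u' ` {..m} \<subseteq> A"
        using Suc.prems(2) i by (auto simp: u'_def image_subset_iff)
      moreover have "h (u' 0) = 0" using Suc.prems(3) i by (simp add: u'_def)
      ultimately have "\<bar>young_sum h g m u'\<bar> \<le> (\<Sum>k<m-1. (2 / Suc k) powr \<theta>) * c"
        by (rule Suc.IH)
      moreover have "\<bar>young_sum h g (Suc m) u - young_sum h g m u'\<bar> \<le> (2 / m) powr \<theta> * c"
        unfolding u'_def young_sum_remove[OF i(1,2)] by (rule i(3))
      ultimately have "\<bar>young_sum h g (Suc m) u\<bar>
          \<le> (\<Sum>k<m-1. (2 / Suc k) powr \<theta>) * c + (2 / m) powr \<theta> * c" by linarith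
      also have "\<dots> = (\<Sum>k<Suc m-1. (2 / Suc k) powr \<theta>) * c"
        using False by (cases m) (auto simp: algebra_simps)
      finally show ?thesis .
    qed
  qed
  also have "\<dots> \<le> young_const \<theta> * c"
    unfolding young_const_def using \<theta>
    by (intro mult_right_mono sum_le_suminf young_const_summable) (auto simp: c_def \<theta>_def)
  finally show ?thesis by (simp add: \<theta>_def c_def)
qed

text \<open>
  The condition \<open>1 / p + 1 / q > 1\<close> is open, so there is room for an exponent \<open>r > p\<close> that still
  satisfies it. The bound in terms of the \<open>r\<close>-variation tends to zero with the supremum of \<open>h\<close> by
  interpolation. That \<open>\<delta>\<close> serves all grids at once is what permits the interchange of limits later.
\<close>

lemma young_sum_small:
  assumes g: "variation_bounded A q g w" and "0 < v" "0 < w" "1 \<le> p" "1 \<le> q"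
    and \<theta>: "1 < 1 / p + 1 / q" and "0 < (\<epsilon>::real)"
  obtains \<delta> where "0 < \<delta>"
    "\<And>h m u. \<lbrakk>variation_bounded A p h v; \<And>x. x \<in> A \<Longrightarrow> \<bar>h x\<bar> \<le> \<delta>;
       strict_mono_on {..m::nat} u; u ` {..m} \<subseteq> A; h (u 0) = 0\<rbrakk> \<Longrightarrow> \<bar>young_sum h g m u\<bar> \<le> \<epsilon>"
proof -
  \<comment> \<open>The reciprocal of the new exponent lies strictly between \<open>1 - 1 / q\<close> and \<open>1 / p\<close>.\<close>
  obtain s where s: "1 - 1 / q < s" "s < 1 / p"
    using dense[of "1 - 1 / q" "1 / p"] \<theta> by auto
  have "1 / q \<le> 1" using assms by simp
  then have "0 < s" using s by linarith
  define r where "r = 1 / s"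
  have "p < r" using s \<open>0 < s\<close> assms(4) by (simp add: r_def field_simps)
  have th: "1 < 1 / r + 1 / q" using s by (simp add: r_def)
  define K where "K = young_const (1 / r + 1 / q)"
  define F where "F = (\<lambda>d. K * (((2 * d) powr (r - p) * v) powr (1 / r) * w powr (1 / q)))"
  have "((\<lambda>d. F d) \<longlongrightarrow> K * (((2 * 0) powr (r - p) * v) powr (1 / r) * w powr (1 / q))) (at_right 0)"
    unfolding F_def using \<open>p < r\<close> assms \<open>1 \<le> p\<close>
    by (intro tendsto_intros tendsto_powr') (auto intro!: eventually_at_rightI[of 0 1])
  then have "(F \<longlongrightarrow> 0) (at_right 0)" by simp
  then have "eventually (\<lambda>d. F d < \<epsilon>) (at_right 0)"
    using \<open>0 < \<epsilon>\<close> by (rule order_tendstoD)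
  moreover have "eventually (\<lambda>d::real. 0 < d) (at_right 0)" by (rule eventually_at_right_less)
  ultimately have "eventually (\<lambda>d. F d < \<epsilon> \<and> 0 < d) (at_right 0)" by eventually_elim auto
  then obtain d where d: "F d < \<epsilon>" "0 < d"
    using eventually_happens'[OF trivial_limit_at_right_real] by blast
  show ?thesis
  proof
    show "0 < d" by fact
  next
    fix h m and u :: "nat \<Rightarrow> real"
    assume h: "variation_bounded A p h v" "\<And>x. x \<in> A \<Longrightarrow> \<bar>h x\<bar> \<le> d"
      and u: "strict_mono_on {..m} u" "u ` {..m} \<subseteq> A" "h (u 0) = 0"
    have "variation_bounded A r h ((2 * d) powr (r - p) * v)"
      using h \<open>p < r\<close> d by (intro variation_bounded_interpolation) auto
    then have "\<bar>young_sum h g m u\<bar> \<le> F d"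
      unfolding F_def K_def using g u th assms \<open>p < r\<close> d
      by (intro young_sum_bound) auto
    then show "\<bar>young_sum h g m u\<bar> \<le> \<epsilon>" using d by simp
  qed
qed


section \<open>Young sums against ramps\<close>

text \<open>
  Where a grid jumps over \<open>x\<close>, the relevant value of a right-continuous integrator is the one at the
  first grid point strictly to the right of \<open>x\<close>.
\<close>

definition next_point :: "(nat \<Rightarrow> real) \<Rightarrow> real \<Rightarrow> real" where
  "next_point u x = u (LEAST k. x < u k)"

lemma next_index:
  assumes D: "partition_of_interval a b m u" and x: "a \<le> x" "x < b"
  obtains k where "k < m" "u k \<le> x" "x < u (Suc k)" "next_point u x = u (Suc k)"
    "\<And>j. j \<le> m \<Longrightarrow> u j \<le> x \<longleftrightarrow> j \<le> k"
proof -
  define l where "l = (LEAST k. x < u k)"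
  have um: "u 0 = a" "u m = b" "strict_mono_on {..m} u"
    using D by (auto simp: partition_of_interval_def)
  have l: "x < u l" "l \<le> m"
    unfolding l_def using um x by (auto intro: LeastI[of "\<lambda>k. x < u k" m] Least_le)
  have l_least: "u j \<le> x" if "j < l" for j
    using not_less_Least[of j "\<lambda>k. x < u k"] that by (simp add: l_def)
  have "l \<noteq> 0" using l um x by (intro notI) auto
  then obtain k where k: "l = Suc k" by (cases l) auto
  have "u j \<le> x \<longleftrightarrow> j \<le> k" if "j \<le> m" for j
  proof
    show "u j \<le> x" if "j \<le> k" using that l_least k by simp
    show "j \<le> k" if "u j \<le> x"
    proof (rule ccontr)
      assume "\<not> j \<le> k"
      then have "u l \<le> u j"
        using \<open>j \<le> m\<close> l k um(3) by (intro strict_mono_on_leD[of "{..m}" u]) auto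
      then show False using that l by simp
    qed
  qed
  then show ?thesis
    using that[of k] l l_least[of k] k by (auto simp: next_point_def l_def)
qed

lemma partition_mem:
  assumes "partition_of_interval a b m u" "k \<le> m"
  shows "u k \<in> {a..b}"
  using assms strict_mono_on_leD[of "{..m}" u 0 k] strict_mono_on_leD[of "{..m}" u k m]
  by (auto simp: partition_of_interval_def)

lemma mesh_ge:
  assumes "j < m"
  shows "u (Suc j) - u j \<le> mesh m u"
  unfolding mesh_def using assms by (intro Max_ge) auto

lemma next_point_bounds:
  assumes D: "partition_of_interval a b m u" and x: "a \<le> x" "x < b"
  shows "x < next_point u x" "next_point u x \<le> x + mesh m u" "next_point u x \<in> {a..b}"
proof -
  from next_index[OF assms] obtain k
    where k: "k < m" "u k \<le> x" "x < u (Suc k)" "next_point u x = u (Suc k)" by metis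
  then show "x < next_point u x" "next_point u x \<le> x + mesh m u" "next_point u x \<in> {a..b}"
    using mesh_ge[of k m u] partition_mem[OF D, of "Suc k"] by auto
qed

lemma next_point_tendsto:
  assumes D: "\<And>n. partition_of_interval a b (m n) (u n)" and mesh: "(\<lambda>n. mesh (m n) (u n)) \<longlonglongrightarrow> 0"
    and x: "a \<le> x" "x < b" and g: "right_continuous g"
  shows "(\<lambda>n. g (next_point (u n) x)) \<longlonglongrightarrow> g x"
proof -
  have "(\<lambda>n. next_point (u n) x) \<longlonglongrightarrow> x"
  proof (rule tendsto_sandwich[where f = "\<lambda>_. x" and h = "\<lambda>n. x + mesh (m n) (u n)"])
    show "(\<lambda>n. x + mesh (m n) (u n)) \<longlonglongrightarrow> x" using tendsto_add[OF tendsto_const mesh] by simp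
    show "(\<lambda>n. x) \<longlonglongrightarrow> x" by simp
    show "\<forall>\<^sub>F n in sequentially. x \<le> next_point (u n) x"
      using next_point_bounds(1)[OF D x] by (intro always_eventually allI less_imp_le)
    show "\<forall>\<^sub>F n in sequentially. next_point (u n) x \<le> x + mesh (m n) (u n)"
      using next_point_bounds(2)[OF D x] by (intro always_eventually allI)
  qed
  then have "filterlim (\<lambda>n. next_point (u n) x) (at_right x) sequentially"
    by (rule tendsto_imp_filterlim_at_right)
      (auto intro!: always_eventually next_point_bounds[OF D x])
  moreover have "(g \<longlongrightarrow> g x) (at_right x)"
    using g by (simp add: right_continuous_def continuous_within)
  ultimately show ?thesis by (rule filterlim_compose[rotated])
qed

lemma telescope_next_point:
  assumes D: "partition_of_interval a b m u" and xy: "a \<le> x" "x \<le> y" "y < b"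
  shows "(\<Sum>j<m. indicator {x<..y} (u j) * (g (u (Suc j)) - g (u j)))
    = g (next_point u y) - (g (next_point u x) :: real)"
proof -
  obtain k where k: "k < m" "next_point u x = u (Suc k)"
      "\<And>j. j \<le> m \<Longrightarrow> u j \<le> x \<longleftrightarrow> j \<le> k" "u k \<le> x"
    using next_index[OF D, of x] xy by (metis le_less_trans)
  obtain l where l: "l < m" "next_point u y = u (Suc l)"
      "\<And>j. j \<le> m \<Longrightarrow> u j \<le> y \<longleftrightarrow> j \<le> l"
    using next_index[OF D, of y] xy by (metis order_trans)
  have "k \<le> l" using k(1,4) l(3)[of k] xy by simp
  have "(\<Sum>j<m. indicator {x<..y} (u j) * (g (u (Suc j)) - g (u j)))
      = (\<Sum>j\<in>{Suc k..<Suc l}. g (u (Suc j)) - g (u j))"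
  proof (rule sum.mono_neutral_cong_right)
    show "\<forall>i\<in>{..<m} - {Suc k..<Suc l}. indicator {x<..y} (u i) * (g (u (Suc i)) - g (u i)) = 0"
      using k(3) l(3) by (auto simp: indicator_def not_le[symmetric])
    show "indicator {x<..y} (u j) * (g (u (Suc j)) - g (u j)) = g (u (Suc j)) - g (u j)"
      if "j \<in> {Suc k..<Suc l}" for j
      using that k(3)[of j] l(3)[of j] l(1) by (auto simp: indicator_def)
  qed (use l in auto)
  also have "\<dots> = g (u (Suc l)) - g (u (Suc k))"
    using \<open>k \<le> l\<close> by (intro sum_Suc_diff') auto
  finally show ?thesis by (simp add: k l)
qed

text \<open>
  A ramp is a mixture of indicators of half-open intervals, whose Young sums telescope.
\<close>

lemma ramp_as_integral:
  fixes v :: real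
  assumes "a \<le> b"
  shows "integrable lborel (\<lambda>x. indicator {a<..b} x * indicator {a<..x} v :: real)"
    and "(LINT x|lborel. indicator {a<..b} x * indicator {a<..x} v) = indicator {a<..b} v * (b - v)"
    and "integrable lborel (\<lambda>x. indicator {a<..b} x * indicator {x<..b} v :: real)"
    and "(LINT x|lborel. indicator {a<..b} x * indicator {x<..b} v) = indicator {a<..b} v * (v - a)"
proof -
  have 1: "(\<lambda>x. indicator {a<..b} x * indicator {a<..x} v) =
      (\<lambda>x. indicator {a<..b} v * indicator {v..b} x :: real)"
    by (auto simp: indicator_def fun_eq_iff)
  have 2: "(\<lambda>x. indicator {a<..b} x * indicator {x<..b} v) =
      (\<lambda>x. indicator {a<..b} v * indicator {a<..<v} x :: real)"
    by (auto simp: indicator_def fun_eq_iff)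
  show "integrable lborel (\<lambda>x. indicator {a<..b} x * indicator {a<..x} v :: real)"
    unfolding 1 by (cases "v \<le> b") auto
  show "integrable lborel (\<lambda>x. indicator {a<..b} x * indicator {x<..b} v :: real)"
    unfolding 2 by (cases "a \<le> v") auto
  show "(LINT x|lborel. indicator {a<..b} x * indicator {a<..x} v) = indicator {a<..b} v * (b - v)"
    unfolding 1 by (cases "v \<in> {a<..b}") auto
  show "(LINT x|lborel. indicator {a<..b} x * indicator {x<..b} v) = indicator {a<..b} v * (v - a)"
    unfolding 2 by (cases "v \<in> {a<..b}") auto
qed

text \<open>
  An indefinite Lebesgue integral: \<open>f\<close> need not be differentiable where \<open>g\<close> jumps.
\<close>

definition antiderivative :: "(real \<Rightarrow> real) \<Rightarrow> (real \<Rightarrow> real) \<Rightarrow> bool" where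
  "antiderivative f g \<longleftrightarrow> (\<forall>a b. a \<le> b \<longrightarrow>
     set_integrable lborel {a<..b} g \<and> f b - f a = (LINT u:{a<..b}|lborel. g u))"

lemma antiderivative_shifted:
  assumes "antiderivative f g" "a \<le> b"
  shows "(LINT x|lborel. indicator {a<..b} x * (g x - c)) = f b - f a - c * (b - a)"
proof -
  have 1: "integrable lborel (\<lambda>x. indicator {a<..b} x * g x)"
    and 2: "f b - f a = (LINT x|lborel. indicator {a<..b} x * g x)"
    using assms by (auto simp: antiderivative_def set_integrable_def set_lebesgue_integral_def)
  have "(LINT x|lborel. indicator {a<..b} x * (g x - c))
      = (LINT x|lborel. indicator {a<..b} x * g x - c * indicator {a<..b} x)"
    by (simp add: algebra_simps)
  also have "\<dots> = (f b - f a) - c * (b - a)"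
    using assms(2) 1 by (subst Bochner_Integration.integral_diff) (auto simp: 2)
  finally show ?thesis .
qed

lemma young_sum_ramp_eq:
  assumes D: "partition_of_interval a b m u" and xy: "a \<le> x" "x \<le> y" "y < b"
  shows "young_sum (\<lambda>v. indicator {x<..y} v * (y - v)) g m u =
      (LINT z|lborel. indicator {x<..y} z * (g (next_point u z) - g (next_point u x)))" (is ?A)
    and "young_sum (\<lambda>v. indicator {x<..y} v * (v - x)) g m u =
      (LINT z|lborel. indicator {x<..y} z * (g (next_point u y) - g (next_point u z)))" (is ?B)
    and "(\<lambda>z. indicator {x<..y} z * (g (next_point u z) - g (next_point u x)))
      \<in> borel_measurable lborel" (is ?C)
    and "(\<lambda>z. indicator {x<..y} z * (g (next_point u y) - g (next_point u z)))
      \<in> borel_measurable lborel" (is ?D)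
proof -
  let ?d = "\<lambda>j. g (u (Suc j)) - g (u j)"
  have e1: "(\<lambda>z. indicator {x<..y} z * (g (next_point u z) - g (next_point u x))) =
      (\<lambda>z. \<Sum>j<m. indicator {x<..y} z * indicator {x<..z} (u j) * ?d j)"
    using telescope_next_point[OF D, of x _ g] xy
    by (intro ext) (auto simp: indicator_def sum_distrib_left)
  have e2: "(\<lambda>z. indicator {x<..y} z * (g (next_point u y) - g (next_point u z))) =
      (\<lambda>z. \<Sum>j<m. indicator {x<..y} z * indicator {z<..y} (u j) * ?d j)"
    using telescope_next_point[OF D, of _ y g] xy
    by (intro ext) (auto simp: indicator_def sum_distrib_left)
  note r = ramp_as_integral[OF xy(2)]
  show ?A unfolding e1 young_sum_def
    using r by (subst Bochner_Integration.integral_sum) auto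
  show ?B unfolding e2 young_sum_def
    using r by (subst Bochner_Integration.integral_sum) auto
  show ?C unfolding e1
    by (intro borel_measurable_sum borel_measurable_times borel_measurable_const
        borel_measurable_integrable[OF r(1)])
  show ?D unfolding e2
    by (intro borel_measurable_sum borel_measurable_times borel_measurable_const
        borel_measurable_integrable[OF r(3)])
qed

lemma integral_interval_tendsto:
  fixes e :: "nat \<Rightarrow> real \<Rightarrow> real"
  assumes "c \<le> d" and lim: "\<And>z. z \<in> {c<..d} \<Longrightarrow> (\<lambda>n. e n z) \<longlonglongrightarrow> e' z"
    and bound: "\<And>n z. z \<in> {c<..d} \<Longrightarrow> \<bar>e n z\<bar> \<le> K"
    and meas: "\<And>n. (\<lambda>z. indicator {c<..d} z * e n z) \<in> borel_measurable lborel"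
  shows "(\<lambda>n. LINT z|lborel. indicator {c<..d} z * e n z)
    \<longlonglongrightarrow> (LINT z|lborel. indicator {c<..d} z * e' z)"
proof -
  have pt: "(\<lambda>n. indicator {c<..d} z * e n z) \<longlonglongrightarrow> indicator {c<..d} z * e' z" for z
    using lim[of z] by (cases "z \<in> {c<..d}") auto
  show ?thesis
  proof (rule integral_dominated_convergence[where w = "\<lambda>z. K * indicator {c<..d} z"])
    show "(\<lambda>z. indicator {c<..d} z * e' z) \<in> borel_measurable lborel"
      using pt meas by (rule borel_measurable_LIMSEQ_real)
    show "AE z in lborel. norm (indicator {c<..d} z * e n z) \<le> K * indicator {c<..d} z" for n
      using bound by (intro AE_I2) (auto simp: indicator_def)
    show "integrable lborel (\<lambda>z. K * indicator {c<..d} z)"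
      using \<open>c \<le> d\<close> by simp
    show "(\<lambda>z. indicator {c<..d} z * e n z) \<in> borel_measurable lborel" for n by (rule meas)
  qed (use pt in auto)
qed

text \<open>
  Here right-continuity enters: \<open>next_point\<close> approaches its argument strictly from the right, so the
  integrands of \<open>young_sum_ramp_eq\<close> converge at every point to \<open>g z - g x\<close> for an ascending step, and to
  \<open>g x - g z\<close> for a descending one. Both limits integrate to the same expression, the remainder of the
  first-order expansion of \<open>f\<close> at \<open>x\<close>.
\<close>

lemma young_sum_ramp_tendsto:
  assumes D: "\<And>n. partition_of_interval a b (m n) (u n)" and mesh: "(\<lambda>n. mesh (m n) (u n)) \<longlonglongrightarrow> 0"
    and xy: "x \<in> {a..<b}" "y \<in> {a..<b}" and g: "right_continuous g"
    and G: "\<And>v. v \<in> {a..b} \<Longrightarrow> \<bar>g v\<bar> \<le> G" and f: "antiderivative f g"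
  shows "(\<lambda>n. young_sum (\<lambda>v. indicator (half_open x y) v * \<bar>y - v\<bar>) g (m n) (u n))
    \<longlonglongrightarrow> f y - f x - g x * (y - x)"
proof -
  have lim: "(\<lambda>n. g (next_point (u n) z)) \<longlonglongrightarrow> g z" if "a \<le> z" "z < b" for z
    using next_point_tendsto[OF D mesh that g] .
  have bd: "\<bar>g (next_point (u n) z) - g (next_point (u n) z')\<bar> \<le> 2 * G"
    if "a \<le> z" "z < b" "a \<le> z'" "z' < b" for z z' n
    using G[OF next_point_bounds(3)[OF D that(1,2), of n]]
      G[OF next_point_bounds(3)[OF D that(3,4), of n]] by linarith
  show ?thesis
  proof (cases "x \<le> y")
    case True
    have xy': "a \<le> x" "y < b" using xy by auto
    note eqs = young_sum_ramp_eq[OF D xy'(1) True xy'(2), where g = g]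
    have "(\<lambda>v. indicator (half_open x y) v * \<bar>y - v\<bar>) = (\<lambda>v. indicator {x<..y} v * (y - v))"
      using True by (auto simp: half_open_def indicator_def)
    then have "young_sum (\<lambda>v. indicator (half_open x y) v * \<bar>y - v\<bar>) g (m n) (u n) =
        (LINT z|lborel. indicator {x<..y} z * (g (next_point (u n) z) - g (next_point (u n) x)))" for n
      using eqs(1) by simp
    moreover have "(\<lambda>n. LINT z|lborel. indicator {x<..y} z * (g (next_point (u n) z) - g (next_point (u n) x)))
        \<longlonglongrightarrow> (LINT z|lborel. indicator {x<..y} z * (g z - g x))"
      using lim bd xy True eqs(3)
      by (intro integral_interval_tendsto[where K = "2 * G"] tendsto_diff) auto
    ultimately show ?thesis using antiderivative_shifted[OF f True] by simp
  next
    case False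
    then have yx: "y \<le> x" by simp
    have xy': "a \<le> y" "x < b" using xy by auto
    note eqs = young_sum_ramp_eq[OF D xy'(1) yx xy'(2), where g = g]
    have "(\<lambda>v. indicator (half_open x y) v * \<bar>y - v\<bar>) = (\<lambda>v. indicator {y<..x} v * (v - y))"
      using False by (auto simp: half_open_def indicator_def)
    then have "young_sum (\<lambda>v. indicator (half_open x y) v * \<bar>y - v\<bar>) g (m n) (u n) =
        (LINT z|lborel. indicator {y<..x} z * (g (next_point (u n) x) - g (next_point (u n) z)))" for n
      using eqs(2) by simp
    moreover have "(\<lambda>n. LINT z|lborel. indicator {y<..x} z * (g (next_point (u n) x) - g (next_point (u n) z)))
        \<longlonglongrightarrow> (LINT z|lborel. indicator {y<..x} z * (g x - g z))"
      using lim bd xy yx eqs(4)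
      by (intro integral_interval_tendsto[where K = "2 * G"] tendsto_diff) auto
    moreover have "(LINT z|lborel. indicator {y<..x} z * (g x - g z))
        = - (LINT z|lborel. indicator {y<..x} z * (g z - g x))"
      by (subst Bochner_Integration.integral_minus[symmetric])
        (intro Bochner_Integration.integral_cong; simp add: algebra_simps)
    moreover have "- (LINT z|lborel. indicator {y<..x} z * (g z - g x)) = f y - f x - g x * (y - x)"
      unfolding antiderivative_shifted[OF f yx] by (simp add: algebra_simps)
    ultimately show ?thesis by simp
  qed
qed


section \<open>Discrete local times\<close>

text \<open>
  Otherwise infinitely many distinct partition points would lie in the compact interval
  \<open>[0, t]\<close> and accumulate there.
\<close>

lemma time_partition_reaches:
  assumes \<tau>: "time_partition \<tau>" and t: "0 \<le> t"
  obtains N where "ereal t \<le> \<tau> N" "\<And>j. j < N \<Longrightarrow> \<tau> j < ereal t"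
proof -
  have "\<exists>N. ereal t \<le> \<tau> N"
  proof (rule ccontr)
    assume "\<not> ?thesis"
    then have less: "\<tau> j < ereal t" for j by (simp add: not_le)
    then have "\<tau> j < \<infinity>" for j by (metis less_ereal.simps(4) less_trans)
    then have mono: "strict_mono \<tau>"
      using \<tau> by (simp add: time_partition_def strict_mono_Suc_iff)
    have nonneg: "0 \<le> \<tau> j" for j
      using \<tau> monoD[OF strict_mono_mono[OF mono], of 0 j] by (simp add: time_partition_def)
    have "\<exists>x. \<tau> j = ereal x \<and> x \<in> {0..t}" for j
      using less[of j] nonneg[of j] by (cases "\<tau> j") auto
    then obtain x where x: "\<And>j. \<tau> j = ereal (x j)" "\<And>j. x j \<in> {0..t}" by metis
    have "inj x" using x(1) strict_mono_eq[OF mono] by (intro injI) (metis)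
    then have "infinite (range x)" by (simp add: finite_image_iff)
    moreover have "range x \<subseteq> {0..t}" using x(2) by blast
    ultimately obtain y where "y \<in> {0..t}" "y islimpt range x"
      using compact_Icc[of 0 t] by (auto simp: compact_eq_Bolzano_Weierstrass)
    moreover have "range x = {s. ereal s \<in> range \<tau>}" using x(1) by auto
    ultimately show False using \<tau> by (auto simp: time_partition_def)
  qed
  then obtain N where "ereal t \<le> \<tau> N" "\<forall>j<N. \<not> ereal t \<le> \<tau> j"
    using exists_least_iff[of "\<lambda>N. ereal t \<le> \<tau> N"] by blast
  then show ?thesis using that by (simp add: not_le)
qed

text \<open>
  The stopped partition with points \<open>min (\<tau> j) t\<close>, described by what is used of it: once \<open>t\<close> is reached all
  increments vanish, so the infinite sums reduce to finite ones.
\<close>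

definition time_grid :: "(nat \<Rightarrow> ereal) \<Rightarrow> real \<Rightarrow> nat \<Rightarrow> (nat \<Rightarrow> real) \<Rightarrow> bool" where
  "time_grid \<tau> t N s \<longleftrightarrow> s 0 = 0 \<and> s N = t \<and> (\<forall>j. s j \<in> {0..t}) \<and>
    (\<forall>S u. discrete_local_time \<tau> S t u =
      (\<Sum>j<N. indicator (half_open (S (s j)) (S (s (Suc j)))) u * \<bar>S (s (Suc j)) - u\<bar>)) \<and>
    (\<forall>S g. riemann_sum \<tau> S g t = (\<Sum>j<N. g (S (s j)) * (S (s (Suc j)) - S (s j))))"

lemma time_gridD:
  assumes "time_grid \<tau> t N s"
  shows "s 0 = 0" "s N = t" "s j \<in> {0..t}"
    "discrete_local_time \<tau> S t u =
      (\<Sum>j<N. indicator (half_open (S (s j)) (S (s (Suc j)))) u * \<bar>S (s (Suc j)) - u\<bar>)"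
    "riemann_sum \<tau> S g t = (\<Sum>j<N. g (S (s j)) * (S (s (Suc j)) - S (s j)))"
proof -
  note g = assms[unfolded time_grid_def]
  show "s 0 = 0" "s N = t" "s j \<in> {0..t}" using g by blast+
  show "discrete_local_time \<tau> S t u =
      (\<Sum>j<N. indicator (half_open (S (s j)) (S (s (Suc j)))) u * \<bar>S (s (Suc j)) - u\<bar>)"
    by (rule g[THEN conjunct2, THEN conjunct2, THEN conjunct2, THEN conjunct1, rule_format])
  show "riemann_sum \<tau> S g t = (\<Sum>j<N. g (S (s j)) * (S (s (Suc j)) - S (s j)))"
    by (rule g[THEN conjunct2, THEN conjunct2, THEN conjunct2, THEN conjunct2, rule_format])
qed

lemma time_partition_grid:
  assumes \<tau>: "time_partition \<tau>" and t: "0 \<le> t"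
  shows "\<exists>N s. time_grid \<tau> t N s"
proof -
  obtain N where N: "ereal t \<le> \<tau> N" "\<And>j. j < N \<Longrightarrow> \<tau> j < ereal t"
    using time_partition_reaches[OF assms] by blast
  have step: "\<tau> j \<le> \<tau> (Suc j)" for j
    using \<tau> unfolding time_partition_def by (cases "\<tau> j < \<infinity>") auto
  then have mono: "i \<le> j \<Longrightarrow> \<tau> i \<le> \<tau> j" for i j by (rule lift_Suc_mono_le)
  have nonneg: "0 \<le> \<tau> j" for j using mono[of 0 j] \<tau> by (simp add: time_partition_def)
  define s where "s = (\<lambda>j. min_time (\<tau> j) t)"
  have s: "s j \<in> {0..t}" for j
    using nonneg[of j] t by (cases "\<tau> j") (auto simp: s_def min_time_def min_def)
  have late: "s j = t" if "N \<le> j" for j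
    using order_trans[OF N(1) mono[OF that]] by (simp add: s_def min_time_def min_absorb2)
  have early: "s j = real_of_ereal (\<tau> j)" if "j < N" for j
    using less_imp_le[OF N(2)[OF that]] by (simp add: s_def min_time_def min_absorb1)
  have fin: "\<tau> j < \<infinity>" if "j < N" for j
    using N(2)[OF that] by (metis less_ereal.simps(4) less_trans)
  show ?thesis
    unfolding time_grid_def
  proof (intro exI[of _ N] exI[of _ s] conjI allI)
    show "s 0 = 0" using \<tau> t by (simp add: s_def min_time_def time_partition_def min_def zero_ereal_def)
    show "s N = t" by (rule late) simp
    show "s j \<in> {0..t}" for j by (rule s)
    show "discrete_local_time \<tau> S t u =
      (\<Sum>j<N. indicator (half_open (S (s j)) (S (s (Suc j)))) u * \<bar>S (s (Suc j)) - u\<bar>)" for S u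
    proof -
      have "discrete_local_time \<tau> S t u =
        (\<Sum>\<^sub>\<infinity>j\<in>{..<N}. indicator (half_open (S (s j)) (S (s (Suc j)))) u * \<bar>S (s (Suc j)) - u\<bar>)"
        unfolding discrete_local_time_def s_def[symmetric]
      proof (rule infsum_cong_neutral)
        fix j assume "j \<in> {j. \<tau> j < \<infinity>} - {..<N}"
        then show "indicator (half_open (S (min_time (\<tau> j) t)) (S (min_time (\<tau> (Suc j)) t))) u
            * \<bar>S (min_time (\<tau> (Suc j)) t) - u\<bar> = 0"
          using late[of j] late[of "Suc j"] by (simp add: s_def half_open_def)
      qed (use fin in \<open>auto simp: s_def\<close>)
      then show ?thesis by simp
    qed
    show "riemann_sum \<tau> S g t = (\<Sum>j<N. g (S (s j)) * (S (s (Suc j)) - S (s j)))" for S g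
    proof -
      have "riemann_sum \<tau> S g t = (\<Sum>\<^sub>\<infinity>j\<in>{..<N}. g (S (s j)) * (S (s (Suc j)) - S (s j)))"
        unfolding riemann_sum_def
      proof (rule infsum_cong_neutral)
        fix j assume "j \<in> {j. \<tau> j < \<infinity>} - {..<N}"
        then show "g (S (real_of_ereal (\<tau> j))) *
            (S (min_time (\<tau> (Suc j)) t) - S (min_time (\<tau> j) t)) = 0"
          using late[of j] late[of "Suc j"] by (simp add: s_def)
      next
        fix j assume "j \<in> {j. \<tau> j < \<infinity>} \<inter> {..<N}"
        then show "g (S (real_of_ereal (\<tau> j))) * (S (min_time (\<tau> (Suc j)) t) - S (min_time (\<tau> j) t))
          = g (S (s j)) * (S (s (Suc j)) - S (s j))"
          using early[of j] by (simp add: s_def)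
      qed (use fin in auto)
      then show ?thesis by simp
    qed
  qed
qed

lemma young_sum_sum:
  "young_sum (\<lambda>v. \<Sum>i\<in>X. F i v) g m u = (\<Sum>i\<in>X. young_sum (F i) g m u)"
  unfolding young_sum_def sum_distrib_right by (rule sum.swap)

text \<open>
  The change of variable formula along a single time partition: the remainders of the steps
  are added up, and the increments of \<open>f\<close> telescope.
\<close>

lemma young_sum_discrete_local_time_tendsto:
  assumes \<tau>: "time_partition \<tau>" and t: "0 \<le> t" and S: "S ` {0..t} \<subseteq> {a..<b}"
    and D: "\<And>n. partition_of_interval a b (m n) (u n)" and mesh: "(\<lambda>n. mesh (m n) (u n)) \<longlonglongrightarrow> 0"
    and g: "right_continuous g" and G: "\<And>v. v \<in> {a..b} \<Longrightarrow> \<bar>g v\<bar> \<le> G"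
    and f: "antiderivative f g"
  shows "(\<lambda>n. young_sum (discrete_local_time \<tau> S t) g (m n) (u n))
    \<longlonglongrightarrow> f (S t) - f (S 0) - riemann_sum \<tau> S g t"
proof -
  obtain N s where grid: "time_grid \<tau> t N s" using time_partition_grid[OF \<tau> t] by blast
  note s = time_gridD(1-3)[OF grid] and dl = time_gridD(4)[OF grid] and rs = time_gridD(5)[OF grid]
  have mem: "S (s j) \<in> {a..<b}" for j using S s(3) by blast
  have "(\<lambda>n. \<Sum>j<N. young_sum (\<lambda>v. indicator (half_open (S (s j)) (S (s (Suc j)))) v
        * \<bar>S (s (Suc j)) - v\<bar>) g (m n) (u n))
      \<longlonglongrightarrow> (\<Sum>j<N. f (S (s (Suc j))) - f (S (s j)) - g (S (s j)) * (S (s (Suc j)) - S (s j)))"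
    by (rule tendsto_sum, rule young_sum_ramp_tendsto[OF D mesh mem mem g G f])
  moreover have "(\<Sum>j<N. f (S (s (Suc j))) - f (S (s j)) - g (S (s j)) * (S (s (Suc j)) - S (s j)))
      = f (S t) - f (S 0) - riemann_sum \<tau> S g t"
    using sum_lessThan_telescope[of "\<lambda>j. f (S (s j))" N] by (simp add: sum_subtractf rs s(1,2))
  moreover have "discrete_local_time \<tau> S t =
      (\<lambda>v. \<Sum>j<N. indicator (half_open (S (s j)) (S (s (Suc j)))) v * \<bar>S (s (Suc j)) - v\<bar>)"
    using dl by (rule ext)
  ultimately show ?thesis by (simp only: young_sum_sum)
qed

lemma discrete_local_time_support:
  assumes \<tau>: "time_partition \<tau>" and t: "0 \<le> t" and S: "S ` {0..t} \<subseteq> {a<..<b}" and u: "u \<notin> {a<..<b}"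
  shows "discrete_local_time \<tau> S t u = 0"
proof -
  obtain N s where grid: "time_grid \<tau> t N s" using time_partition_grid[OF \<tau> t] by blast
  have mem: "S (s j) \<in> {a<..<b}" for j using S time_gridD(3)[OF grid] by blast
  have "u \<notin> half_open (S (s j)) (S (s (Suc j)))" for j
    using u mem[of j] mem[of "Suc j"] by (auto simp: half_open_def)
  then show ?thesis by (simp add: time_gridD(4)[OF grid])
qed

lemma variation_bounded_imp_bounded:
  assumes "variation_bounded {a..b} q g w" "1 \<le> q"
  obtains G where "\<And>x. x \<in> {a..b} \<Longrightarrow> \<bar>g x\<bar> \<le> G"
proof
  fix x assume x: "x \<in> {a..b}"
  show "\<bar>g x\<bar> \<le> \<bar>g a\<bar> + \<bar>w\<bar> powr (1 / q)"
  proof (cases "x = a")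
    case False
    define u :: "nat \<Rightarrow> real" where "u = (\<lambda>k. if k = 0 then a else x)"
    have "strict_mono_on {..1} u" "u ` {..1} \<subseteq> {a..b}"
      using x False by (auto simp: u_def strict_mono_on_def)
    from variation_boundedD[OF assms(1) this] have "\<bar>g x - g a\<bar> powr q \<le> w"
      by (simp add: u_def)
    then have "(\<bar>g x - g a\<bar> powr q) powr (1 / q) \<le> \<bar>w\<bar> powr (1 / q)"
      using assms(2) by (intro powr_mono2) auto
    then show ?thesis using assms(2) by (simp add: powr_powr)
  qed simp
qed

lemma uniform_partition:
  assumes "a < b"
  shows "partition_of_interval a b (Suc n) (\<lambda>k. a + real k * ((b - a) / Suc n))"
    and "mesh (Suc n) (\<lambda>k. a + real k * ((b - a) / Suc n)) = (b - a) / Suc n"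
proof -
  define d where "d = (b - a) / real (Suc n)"
  have d: "0 < d" "a + real (Suc n) * d = b" using assms by (auto simp: d_def)
  have "strict_mono_on {..Suc n} (\<lambda>k. a + real k * d)"
    using d(1) by (intro strict_mono_onI) simp
  then show "partition_of_interval a b (Suc n) (\<lambda>k. a + real k * ((b - a) / Suc n))"
    using d(2) unfolding partition_of_interval_def d_def[symmetric] by simp
  have "(\<lambda>j. a + real (Suc j) * d - (a + real j * d)) = (\<lambda>j. d)"
    by (simp add: algebra_simps)
  then have "mesh (Suc n) (\<lambda>k. a + real k * d) = Max ((\<lambda>j. d) ` {..<Suc n})"
    by (simp only: mesh_def)
  also have "\<dots> = d" by (simp add: image_constant_conv lessThan_Suc)
  finally have "mesh (Suc n) (\<lambda>k. a + real k * d) = d" .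
  then show "mesh (Suc n) (\<lambda>k. a + real k * ((b - a) / Suc n)) = (b - a) / Suc n"
    by (simp add: d_def)
qed

lemma uniform_mesh_tendsto: "(\<lambda>n. (c::real) / Suc n) \<longlonglongrightarrow> 0"
  using tendsto_mult[OF tendsto_const[of c] LIMSEQ_inverse_real_of_nat]
  by (simp add: divide_inverse)

section \<open>Enlarging grids\<close>

text \<open>
  The Young integral over the line is tested on intervals that contain the support of the local
  time but perhaps not the supports of its discrete approximations, which spread over the whole range of
  the path. Grids of such an interval are therefore extended to a larger one by uniform grids on
  both sides, at which the limiting integrand vanishes.
\<close>

definition concat_partition :: "nat \<Rightarrow> (nat \<Rightarrow> real) \<Rightarrow> (nat \<Rightarrow> real) \<Rightarrow> nat \<Rightarrow> real" where
  "concat_partition N w u k = (if k \<le> N then w k else u (k - N))"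

lemma partition_length_pos:
  assumes "partition_of_interval a b m u" "a < b"
  shows "0 < m"
  using assms by (cases m) (auto simp: partition_of_interval_def)

lemma partition_concat:
  assumes w: "partition_of_interval a b N w" and u: "partition_of_interval b c m u"
    and abc: "a < b" "b < c"
  shows "partition_of_interval a c (N + m) (concat_partition N w u)"
    and "mesh (N + m) (concat_partition N w u) \<le> max (mesh N w) (mesh m u)"
    and "young_sum h g (N + m) (concat_partition N w u) = young_sum h g N w + young_sum h g m u"
proof -
  have m: "0 < m" "0 < N" using partition_length_pos w u abc by auto
  have wu: "w N = u 0" using w u by (simp add: partition_of_interval_def)
  have c: "concat_partition N w u (N + k) = u k" for k
    using wu by (simp add: concat_partition_def)
  have c': "concat_partition N w u k = w k" if "k \<le> N" for k
    using that by (simp add: concat_partition_def)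
  have mono_w: "strict_mono_on {..N} w" and mono_u: "strict_mono_on {..m} u"
    using w u by (auto simp: partition_of_interval_def)
  have "strict_mono_on {..N + m} (concat_partition N w u)"
  proof (rule strict_mono_onI)
    fix i j assume ij: "i \<in> {..N + m}" "j \<in> {..N + m}" "i < j"
    consider "j \<le> N" | "i \<le> N" "N < j" | "N < i" by linarith
    then show "concat_partition N w u i < concat_partition N w u j"
    proof cases
      case 1
      then show ?thesis using ij strict_mono_onD[OF mono_w, of i j] by (simp add: c')
    next
      case 2
      then have "w i \<le> w N" using strict_mono_on_leD[OF mono_w, of i N] by simp
      moreover have "u 0 < u (j - N)" using 2 ij strict_mono_onD[OF mono_u, of 0 "j - N"] by simp
      ultimately show ?thesis using 2 wu by (simp add: concat_partition_def)
    next
      case 3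
      then show ?thesis using ij strict_mono_onD[OF mono_u, of "i - N" "j - N"]
        by (simp add: concat_partition_def)
    qed
  qed
  then show "partition_of_interval a c (N + m) (concat_partition N w u)"
    using w u c[of m] c'[of 0] by (simp add: partition_of_interval_def)
  have "concat_partition N w u (Suc k) - concat_partition N w u k \<le> max (mesh N w) (mesh m u)"
    if "k < N + m" for k
  proof (cases "k < N")
    case True
    then show ?thesis using mesh_ge[OF True, of w] by (simp add: c' le_max_iff_disj)
  next
    case False
    then obtain l where l: "k = N + l" by (metis le_Suc_ex not_less)
    then show ?thesis using that mesh_ge[of l m u] c[of "Suc l"] c[of l] by (simp add: le_max_iff_disj)
  qed
  then show "mesh (N + m) (concat_partition N w u) \<le> max (mesh N w) (mesh m u)"
    using m unfolding mesh_def[of "N + m"] by (subst Max_le_iff) auto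
  have "young_sum h g (N + m) (concat_partition N w u) =
     (\<Sum>j<N. h (concat_partition N w u j) * (g (concat_partition N w u (Suc j)) - g (concat_partition N w u j)))
     + (\<Sum>j<m. h (u j) * (g (u (Suc j)) - g (u j)))"
    unfolding young_sum_def sum_lessThan_split using c[of "Suc _"] by (simp add: c)
  then show "young_sum h g (N + m) (concat_partition N w u) = young_sum h g N w + young_sum h g m u"
    by (simp add: young_sum_def c')
qed

lemma young_sum_eq_0:
  assumes "partition_of_interval a b m u" "\<And>x. x \<in> {a..b} \<Longrightarrow> h x = 0"
  shows "young_sum h g m u = 0"
  unfolding young_sum_def using partition_mem[OF assms(1)] assms(2) by (intro sum.neutral) auto

lemma mesh_nonneg:
  assumes "partition_of_interval a b m u" "a < b"
  shows "0 \<le> mesh m u"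
proof -
  have "0 < m" using partition_length_pos[OF assms] .
  moreover have "u 0 \<le> u (Suc 0)"
    using assms \<open>0 < m\<close> strict_mono_on_leD[of "{..m}" u 0 "Suc 0"] by (simp add: partition_of_interval_def)
  ultimately show ?thesis using mesh_ge[of 0 m u] by simp
qed

lemma partition_extension:
  assumes D: "\<And>n. partition_of_interval a b (m n) (u n)" and mesh: "(\<lambda>n. mesh (m n) (u n)) \<longlonglongrightarrow> 0"
    and ab: "A < a" "a < b" "b < B" and h: "\<And>x. x \<notin> {a<..<b} \<Longrightarrow> h x = 0"
  obtains m' u' where "\<And>n. partition_of_interval A B (m' n) (u' n)"
    "(\<lambda>n. mesh (m' n) (u' n)) \<longlonglongrightarrow> 0"
    "\<And>n. young_sum h g (m' n) (u' n) = young_sum h g (m n) (u n)"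
proof -
  define l where "l = (\<lambda>n k. A + real k * ((a - A) / Suc n))"
  define r where "r = (\<lambda>n k. b + real k * ((B - b) / Suc n))"
  have lp: "partition_of_interval A a (Suc n) (l n)" "mesh (Suc n) (l n) = (a - A) / Suc n" for n
    unfolding l_def by (rule uniform_partition[OF ab(1)])+
  have rp: "partition_of_interval b B (Suc n) (r n)" "mesh (Suc n) (r n) = (B - b) / Suc n" for n
    unfolding r_def by (rule uniform_partition[OF ab(3)])+
  define u1 where "u1 = (\<lambda>n. concat_partition (Suc n) (l n) (u n))"
  define u' where "u' = (\<lambda>n. concat_partition (Suc n + m n) (u1 n) (r n))"
  have c1: "partition_of_interval A b (Suc n + m n) (u1 n)"
      "mesh (Suc n + m n) (u1 n) \<le> max (mesh (Suc n) (l n)) (mesh (m n) (u n))"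
      "young_sum h g (Suc n + m n) (u1 n) = young_sum h g (Suc n) (l n) + young_sum h g (m n) (u n)" for n
    unfolding u1_def by (rule partition_concat[OF lp(1) D ab(1,2)])+
  have "A < b" using ab by simp
  have c2: "partition_of_interval A B (Suc n + m n + Suc n) (u' n)"
      "mesh (Suc n + m n + Suc n) (u' n) \<le> max (mesh (Suc n + m n) (u1 n)) (mesh (Suc n) (r n))"
      "young_sum h g (Suc n + m n + Suc n) (u' n) =
        young_sum h g (Suc n + m n) (u1 n) + young_sum h g (Suc n) (r n)" for n
    unfolding u'_def by (rule partition_concat[OF c1(1) rp(1) \<open>A < b\<close> ab(3)])+
  show ?thesis
  proof (rule that)
    show p: "partition_of_interval A B (Suc n + m n + Suc n) (u' n)" for n by (rule c2(1))
    show "(\<lambda>n. mesh (Suc n + m n + Suc n) (u' n)) \<longlonglongrightarrow> 0"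
    proof (rule tendsto_sandwich)
      show "\<forall>\<^sub>F n in sequentially. 0 \<le> mesh (Suc n + m n + Suc n) (u' n)"
        using mesh_nonneg[OF p] ab by (intro always_eventually) auto
      show "\<forall>\<^sub>F n in sequentially. mesh (Suc n + m n + Suc n) (u' n)
        \<le> max (max ((a - A) / Suc n) (mesh (m n) (u n))) ((B - b) / Suc n)"
      proof (intro always_eventually allI)
        fix n
        have "mesh (Suc n + m n) (u1 n) \<le> max ((a - A) / Suc n) (mesh (m n) (u n))"
          using c1(2)[of n] unfolding lp(2) .
        moreover have "mesh (Suc n + m n + Suc n) (u' n) \<le> max (mesh (Suc n + m n) (u1 n)) ((B - b) / Suc n)"
          using c2(2)[of n] unfolding rp(2) .
        ultimately show "mesh (Suc n + m n + Suc n) (u' n)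
            \<le> max (max ((a - A) / Suc n) (mesh (m n) (u n))) ((B - b) / Suc n)"
          by (meson max.mono order_refl order_trans)
      qed
      show "(\<lambda>n. max (max ((a - A) / Suc n) (mesh (m n) (u n))) ((B - b) / Suc n)) \<longlonglongrightarrow> 0"
        using tendsto_max[OF tendsto_max[OF uniform_mesh_tendsto mesh] uniform_mesh_tendsto] by simp
    qed simp
    show "young_sum h g (Suc n + m n + Suc n) (u' n) = young_sum h g (m n) (u n)" for n
      using c1(3) c2(3) young_sum_eq_0[OF lp(1)] young_sum_eq_0[OF rp(1)] h by auto
  qed
qed


section \<open>Indefinite integrals\<close>

lemma antiderivative_lipschitz:
  assumes f: "antiderivative f g" and G: "\<And>z. z \<in> {a..b} \<Longrightarrow> \<bar>g z\<bar> \<le> G"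
    and xy: "x \<in> {a..b}" "y \<in> {a..b}"
  shows "\<bar>f y - f x\<bar> \<le> G * \<bar>y - x\<bar>"
proof -
  have *: "\<bar>f y - f x\<bar> \<le> G * \<bar>y - x\<bar>" if xy: "x \<in> {a..b}" "y \<in> {a..b}" "x \<le> y" for x y
  proof -
    have "integrable lborel (\<lambda>z. indicator {x<..y} z * g z)"
      and eq: "f y - f x = (LINT z|lborel. indicator {x<..y} z * g z)"
      using f xy(3) by (auto simp: antiderivative_def set_integrable_def set_lebesgue_integral_def)
    then have "\<bar>f y - f x\<bar> \<le> (LINT z|lborel. \<bar>indicator {x<..y} z * g z\<bar>)"
      by (simp add: integral_abs_bound)
    also have "\<dots> \<le> (LINT z|lborel. G * indicator {x<..y} z)"
    proof (rule integral_mono)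
      show "integrable lborel (\<lambda>z. G * indicator {x<..y} z)" using xy by simp
      show "\<bar>indicator {x<..y} z * g z\<bar> \<le> G * indicator {x<..y} z" for z
        using G[of z] xy by (auto simp: indicator_def)
      show "integrable lborel (\<lambda>z. \<bar>indicator {x<..y} z * g z\<bar>)"
        by (intro integrable_abs) fact
    qed
    also have "\<dots> = G * \<bar>y - x\<bar>" using xy by simp
    finally show ?thesis .
  qed
  show ?thesis
  proof (cases "x \<le> y")
    case True
    then show ?thesis using * xy by blast
  next
    case False
    then show ?thesis using *[OF xy(2,1)] by (simp add: abs_minus_commute)
  qed
qed

text \<open>
  A right-continuous function is the pointwise limit of its values at the next multiple of
  \<open>1 / (n + 1)\<close> strictly to the right.
\<close>

lemma right_continuous_borel_measurable:
  assumes "right_continuous g"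
  shows "g \<in> borel_measurable borel"
proof (rule borel_measurable_LIMSEQ_real)
  fix n :: nat
  have "(\<lambda>k. g ((real_of_int k + 1) / Suc n)) \<in> measurable (count_space UNIV) borel" by simp
  moreover have "(\<lambda>x::real. \<lfloor>real (Suc n) * x\<rfloor>) \<in> measurable borel (count_space UNIV)"
    by measurable
  ultimately show "(\<lambda>x. g ((real_of_int \<lfloor>real (Suc n) * x\<rfloor> + 1) / Suc n)) \<in> borel_measurable borel"
    by (rule measurable_compose[rotated])
next
  fix x :: real
  let ?d = "\<lambda>n. (real_of_int \<lfloor>real (Suc n) * x\<rfloor> + 1) / Suc n"
  have gt: "x < ?d n" for n
  proof -
    have "real (Suc n) * x < real_of_int \<lfloor>real (Suc n) * x\<rfloor> + 1" by (rule real_of_int_floor_add_one_gt)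
    then show ?thesis by (simp only: pos_less_divide_eq of_nat_0_less_iff zero_less_Suc mult.commute)
  qed
  have le: "?d n \<le> x + 1 / Suc n" for n
  proof -
    have "real_of_int \<lfloor>real (Suc n) * x\<rfloor> + 1 \<le> real (Suc n) * x + 1"
      by (rule add_right_mono) (rule of_int_floor_le)
    then have "?d n \<le> (real (Suc n) * x + 1) / Suc n"
      by (rule divide_right_mono) simp
    also have "\<dots> = x + 1 / Suc n" by (simp add: add_divide_distrib del: of_nat_Suc)
    finally show ?thesis .
  qed
  have "?d \<longlonglongrightarrow> x"
  proof (rule tendsto_sandwich[where f = "\<lambda>_. x" and h = "\<lambda>n. x + 1 / Suc n"])
    show "\<forall>\<^sub>F n in sequentially. x \<le> ?d n"
      using gt by (intro always_eventually allI less_imp_le)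
    show "\<forall>\<^sub>F n in sequentially. ?d n \<le> x + 1 / Suc n"
      using le by (intro always_eventually allI)
    show "(\<lambda>n. x + 1 / Suc n) \<longlonglongrightarrow> x"
      using tendsto_add[OF tendsto_const uniform_mesh_tendsto, of x 1] by simp
  qed simp
  then have "filterlim ?d (at_right x) sequentially"
    by (rule tendsto_imp_filterlim_at_right) (rule always_eventually, rule allI, rule gt)
  moreover have "(g \<longlongrightarrow> g x) (at_right x)"
    using assms by (simp add: right_continuous_def continuous_within)
  ultimately show "(\<lambda>n. g (?d n)) \<longlonglongrightarrow> g x" by (rule filterlim_compose[rotated])
qed

lemma antiderivative_exists:
  assumes g: "right_continuous g" and bounded: "\<And>a b. \<exists>G. \<forall>x\<in>{a..b}. \<bar>g x\<bar> \<le> G"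
  obtains f where "antiderivative f g"
proof -
  have int: "set_integrable lborel {a<..b} g" if "a \<le> b" for a b
  proof -
    obtain G where G: "\<forall>x\<in>{a..b}. \<bar>g x\<bar> \<le> G" using bounded by blast
    have "integrable lborel (\<lambda>x. indicator {a<..b} x * g x)"
    proof (rule Bochner_Integration.integrable_bound)
      show "integrable lborel (\<lambda>x. G * indicator {a<..b} x)" using that by simp
      show "(\<lambda>x. indicator {a<..b} x * g x) \<in> borel_measurable lborel"
        using right_continuous_borel_measurable[OF g] by measurable
      show "AE x in lborel. norm (indicator {a<..b} x * g x) \<le> norm (G * indicator {a<..b} x)"
      proof (rule AE_I2)
        fix x show "norm (indicator {a<..b} x * g x) \<le> norm (G * indicator {a<..b} x)"
          using G[rule_format, of x] by (cases "x \<in> {a<..b}") auto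
      qed
    qed
    then show ?thesis by (simp add: set_integrable_def)
  qed
  have iint: "interval_lebesgue_integrable lborel (ereal a) (ereal b) g" if "a \<le> b" for a b
  proof -
    have "set_integrable lborel {a<..<b} g"
      by (rule set_integrable_subset[OF int[OF that]]) auto
    then show ?thesis using that by (simp add: interval_lebesgue_integrable_def einterval_eq)
  qed
  define f where "f = (\<lambda>x. LBINT u=ereal 0..ereal x. g u)"
  have "f b - f a = (LINT u:{a<..b}|lborel. g u)" if "a \<le> b" for a b
  proof -
    have "(LBINT u=ereal 0..ereal a. g u) + (LBINT u=ereal a..ereal b. g u) = (LBINT u=ereal 0..ereal b. g u)"
    proof (rule interval_integral_sum)
      have "min (ereal 0) (min (ereal a) (ereal b)) = ereal (min 0 (min a b))"
        "max (ereal 0) (max (ereal a) (ereal b)) = ereal (max 0 (max a b))"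
        by (auto simp: min_def max_def)
      then show "interval_lebesgue_integrable lborel (min (ereal 0) (min (ereal a) (ereal b)))
         (max (ereal 0) (max (ereal a) (ereal b))) g"
        using iint[of "min 0 (min a b)" "max 0 (max a b)"] by simp
    qed
    then show ?thesis using that by (simp add: f_def interval_integral_Ioc)
  qed
  then have "antiderivative f g" using int by (auto simp: antiderivative_def)
  then show ?thesis by (rule that)
qed

section \<open>The change of variable formula\<close>

text \<open>
  The interchange of limits. Write \<open>J n\<close> for the limit of the Young sums of the \<open>n\<close>-th discrete local
  time as the mesh tends to zero. Uniformly over all grids these Young sums are close to those of \<open>l\<close>
  for large \<open>n\<close>. Comparing two indices along one and the same sequence of grids shows that \<open>J\<close> is a
  Cauchy sequence, and its limit is also the limit of the Young sums of \<open>l\<close>. The interval contains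
  the range of the path in its interior, so all integrands vanish at the first grid point, as the
  inequality of Young and Loeve requires.
\<close>

lemma local_time_formula_bounded_range:
  assumes pq: "1 \<le> p" "1 \<le> q" "1 < 1 / p + 1 / q"
    and \<pi>: "\<And>n. time_partition (\<pi> n)" and t: "0 \<le> t"
    and l: "uniform_limit UNIV (\<lambda>n. discrete_local_time (\<pi> n) S t) l sequentially"
    and S: "S ` {0..t} \<subseteq> {a<..<b}" and ab: "a < b"
    and v: "\<And>n. variation_bounded UNIV p (discrete_local_time (\<pi> n) S t) v" "0 < v"
    and g: "right_continuous g" and w: "variation_bounded {a..b} q g w" "0 < w"
    and f: "antiderivative f g"
  obtains I where "(\<lambda>n. riemann_sum (\<pi> n) S g t) \<longlonglongrightarrow> f (S t) - f (S 0) - I"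
    "\<And>m u. \<lbrakk>\<And>n. partition_of_interval a b (m n) (u n); (\<lambda>n. mesh (m n) (u n)) \<longlonglongrightarrow> 0\<rbrakk>
      \<Longrightarrow> (\<lambda>n. young_sum l g (m n) (u n)) \<longlonglongrightarrow> I"
proof -
  let ?L = "\<lambda>n. discrete_local_time (\<pi> n) S t"
  define J where "J = (\<lambda>n. f (S t) - f (S 0) - riemann_sum (\<pi> n) S g t)"
  obtain G where G: "\<And>x. x \<in> {a..b} \<Longrightarrow> \<bar>g x\<bar> \<le> G"
    using variation_bounded_imp_bounded[OF w(1) pq(2)] by metis
  have S': "S ` {0..t} \<subseteq> {a..<b}" using S by auto
  have step: "(\<lambda>k. young_sum (?L n) g (m k) (u k)) \<longlonglongrightarrow> J n"
    if "\<And>k. partition_of_interval a b (m k) (u k)" "(\<lambda>k. mesh (m k) (u k)) \<longlonglongrightarrow> 0" for n m u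
    unfolding J_def by (rule young_sum_discrete_local_time_tendsto[OF \<pi> t S' that g G f])
  have pt: "(\<lambda>n. ?L n x) \<longlonglongrightarrow> l x" for x
    using tendsto_uniform_limitI[OF l] by simp
  have lv: "variation_bounded UNIV p l v"
    using v(1) pt pq(1) by (rule variation_bounded_limit)
  have La: "?L n a = 0" for n using discrete_local_time_support[OF \<pi> t S] by simp
  have la: "l a = 0" using pt[of a] by (simp add: La LIMSEQ_const_iff)
  have close: "\<exists>n0. \<forall>n\<ge>n0. \<forall>m u. partition_of_interval a b m u \<longrightarrow>
      \<bar>young_sum (?L n) g m u - young_sum l g m u\<bar> \<le> \<epsilon>" if "0 < \<epsilon>" for \<epsilon>
  proof -
    have v': "0 < 2 powr p * (v + v)" using v(2) by simp
    obtain \<delta> where \<delta>: "0 < \<delta>" and small: "\<And>h m u. \<lbrakk>variation_bounded {a..b} p h (2 powr p * (v + v));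
        \<And>x. x \<in> {a..b} \<Longrightarrow> \<bar>h x\<bar> \<le> \<delta>; strict_mono_on {..m::nat} u; u ` {..m} \<subseteq> {a..b}; h (u 0) = 0\<rbrakk>
        \<Longrightarrow> \<bar>young_sum h g m u\<bar> \<le> \<epsilon>"
      using young_sum_small[OF w(1) v' w(2) pq \<open>0 < \<epsilon>\<close>] by metis
    have "eventually (\<lambda>n. \<forall>x\<in>UNIV. dist (?L n x) (l x) < \<delta>) sequentially"
      using uniform_limitD[OF l \<delta>] .
    then obtain n0 where n0: "\<And>n x. n \<ge> n0 \<Longrightarrow> \<bar>?L n x - l x\<bar> < \<delta>"
      by (auto simp: eventually_sequentially dist_real_def)
    show ?thesis
    proof (intro exI[of _ n0] allI impI)
      fix n m u assume n: "n0 \<le> n" and D: "partition_of_interval a b m u"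
      have "variation_bounded {a..b} p (\<lambda>x. ?L n x - l x) (2 powr p * (v + v))"
        using variation_bounded_diff[OF v(1) lv pq(1)] by (rule variation_bounded_weaken) auto
      then have "\<bar>young_sum (\<lambda>x. ?L n x - l x) g m u\<bar> \<le> \<epsilon>"
      proof (rule small)
        show "\<bar>?L n x - l x\<bar> \<le> \<delta>" for x using n0[OF n, of x] by simp
        show "strict_mono_on {..m} u" "?L n (u 0) - l (u 0) = 0"
          using D by (auto simp: partition_of_interval_def La la)
        show "u ` {..m} \<subseteq> {a..b}" using partition_mem[OF D] by auto
      qed
      then show "\<bar>young_sum (?L n) g m u - young_sum l g m u\<bar> \<le> \<epsilon>" by (simp add: young_sum_diff)
    qed
  qed
  have J_close: "\<exists>n0. \<forall>n\<ge>n0. \<forall>m u. (\<forall>k. partition_of_interval a b (m k) (u k)) \<longrightarrow>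
      (\<lambda>k. mesh (m k) (u k)) \<longlonglongrightarrow> 0 \<longrightarrow>
      (\<forall>\<^sub>F k in sequentially. \<bar>J n - young_sum l g (m k) (u k)\<bar> \<le> \<epsilon>)" if "0 < \<epsilon>" for \<epsilon>
  proof -
    have "0 < \<epsilon> / 2" using that by simp
    then obtain n0 where n0: "\<And>n m u. n \<ge> n0 \<Longrightarrow> partition_of_interval a b m u \<Longrightarrow>
      \<bar>young_sum (?L n) g m u - young_sum l g m u\<bar> \<le> \<epsilon> / 2" using close by blast
    show ?thesis
    proof (intro exI[of _ n0] allI impI)
      fix n m u assume n: "n0 \<le> n" and D: "\<forall>k. partition_of_interval a b (m k) (u k)"
        and mesh: "(\<lambda>k. mesh (m k) (u k)) \<longlonglongrightarrow> 0"
      have "\<forall>\<^sub>F k in sequentially. dist (young_sum (?L n) g (m k) (u k)) (J n) < \<epsilon> / 2"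
        using step[of m u n] D mesh \<open>0 < \<epsilon> / 2\<close> by (intro tendstoD) auto
      then show "\<forall>\<^sub>F k in sequentially. \<bar>J n - young_sum l g (m k) (u k)\<bar> \<le> \<epsilon>"
      proof eventually_elim
        case (elim k)
        then show ?case using n0[OF n, of "m k" "u k"] D unfolding dist_real_def by (smt (verit) field_sum_of_halves)
      qed
    qed
  qed
  have "Cauchy J"
  proof (rule metric_CauchyI)
    fix \<epsilon> :: real assume "0 < \<epsilon>"
    then have "0 < \<epsilon> / 3" by simp
    then obtain n0 where n0: "\<And>n m u. n \<ge> n0 \<Longrightarrow> (\<forall>k. partition_of_interval a b (m k) (u k)) \<Longrightarrow>
        (\<lambda>k. mesh (m k) (u k)) \<longlonglongrightarrow> 0 \<Longrightarrow>
        (\<forall>\<^sub>F k in sequentially. \<bar>J n - young_sum l g (m k) (u k)\<bar> \<le> \<epsilon> / 3)"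
      using J_close by meson
    have "dist (J i) (J j) < \<epsilon>" if ij: "i \<ge> n0" "j \<ge> n0" for i j
    proof -
      let ?m = "\<lambda>k. Suc k" let ?u = "\<lambda>n k. a + real k * ((b - a) / Suc n)"
      have D: "\<forall>k. partition_of_interval a b (?m k) (?u k)"
        using uniform_partition(1)[OF ab] by blast
      have mesh: "(\<lambda>k. mesh (?m k) (?u k)) \<longlonglongrightarrow> 0"
        unfolding uniform_partition(2)[OF ab] by (rule uniform_mesh_tendsto)
      have "\<forall>\<^sub>F k in sequentially. dist (J i) (J j) < \<epsilon>"
        using n0[OF ij(1) D mesh] n0[OF ij(2) D mesh]
        by eventually_elim (use \<open>0 < \<epsilon>\<close> in \<open>unfold dist_real_def, argo\<close>)
      then show ?thesis by simp
    qed
    then show "\<exists>M. \<forall>m\<ge>M. \<forall>n\<ge>M. dist (J m) (J n) < \<epsilon>" by blast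
  qed
  then obtain I where I: "J \<longlonglongrightarrow> I" by (auto simp: Cauchy_convergent_iff convergent_def)
  show ?thesis
  proof (rule that[of I])
    have "(\<lambda>n. f (S t) - f (S 0) - J n) \<longlonglongrightarrow> f (S t) - f (S 0) - I"
      using I by (intro tendsto_intros)
    then show "(\<lambda>n. riemann_sum (\<pi> n) S g t) \<longlonglongrightarrow> f (S t) - f (S 0) - I" by (simp add: J_def)
  next
    fix m u assume D: "\<And>n. partition_of_interval a b (m n) (u n)"
      and mesh: "(\<lambda>n. mesh (m n) (u n)) \<longlonglongrightarrow> 0"
    show "(\<lambda>n. young_sum l g (m n) (u n)) \<longlonglongrightarrow> I"
    proof (rule tendstoI)
      fix \<epsilon> :: real assume "0 < \<epsilon>"
      then have "0 < \<epsilon> / 2" by simp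
      then obtain n0 where n0: "\<And>n. n \<ge> n0 \<Longrightarrow>
          (\<forall>\<^sub>F k in sequentially. \<bar>J n - young_sum l g (m k) (u k)\<bar> \<le> \<epsilon> / 2)"
        using J_close D mesh by meson
      have "\<forall>\<^sub>F n in sequentially. dist (J n) I < \<epsilon> / 2" using I \<open>0 < \<epsilon> / 2\<close> by (rule tendstoD)
      then obtain n1 where n1: "\<And>n. n \<ge> n1 \<Longrightarrow> dist (J n) I < \<epsilon> / 2"
        by (auto simp: eventually_sequentially)
      have "\<forall>\<^sub>F k in sequentially. \<bar>J (max n0 n1) - young_sum l g (m k) (u k)\<bar> \<le> \<epsilon> / 2"
        by (rule n0) simp
      then show "\<forall>\<^sub>F k in sequentially. dist (young_sum l g (m k) (u k)) I < \<epsilon>"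
      proof eventually_elim
        case (elim k)
        have "dist (J (max n0 n1)) I < \<epsilon> / 2" by (rule n1) simp
        with elim show ?case unfolding dist_real_def by argo
      qed
    qed
  qed
qed


lemma continuous_image_in_interval:
  fixes S :: "real \<Rightarrow> real"
  assumes "continuous_on {0..} S"
  obtains a b where "a < b" "S ` {0..T} \<subseteq> {a<..<b}"
proof -
  have "compact (S ` {0..T})"
    by (intro compact_continuous_image continuous_on_subset[OF assms]) auto
  then obtain M where M: "\<And>x. x \<in> S ` {0..T} \<Longrightarrow> \<bar>x\<bar> \<le> M"
    using compact_imp_bounded bounded_real by metis
  show ?thesis
  proof (rule that)
    show "- \<bar>M\<bar> - 1 < \<bar>M\<bar> + 1" by simp
    show "S ` {0..T} \<subseteq> {- \<bar>M\<bar> - 1<..<\<bar>M\<bar> + 1}" using M by fastforce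
  qed
qed

lemma limit_support:
  assumes \<pi>: "\<And>n. time_partition (\<pi> n)" and t: "0 \<le> t"
    and l: "uniform_limit UNIV (\<lambda>n. discrete_local_time (\<pi> n) S t) l sequentially"
    and S: "S ` {0..t} \<subseteq> {a<..<b}" and x: "x \<notin> {a<..<b}"
  shows "l x = 0"
  using tendsto_uniform_limitI[OF l, of x] discrete_local_time_support[OF \<pi> t S x]
  by (simp add: LIMSEQ_const_iff)

text \<open>
  The value of the integral does not depend on the test interval, because it is determined by the
  limit of the Riemann sums, in which no interval occurs.
\<close>

lemma young_integral_line_formula:
  assumes pq: "1 \<le> p" "1 \<le> q" "1 < 1 / p + 1 / q"
    and \<pi>: "\<And>n. time_partition (\<pi> n)" and t: "0 \<le> t"
    and l: "uniform_limit UNIV (\<lambda>n. discrete_local_time (\<pi> n) S t) l sequentially"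
    and cont: "continuous_on UNIV l" and S: "continuous_on {0..} S"
    and v: "\<And>n. variation_bounded UNIV p (discrete_local_time (\<pi> n) S t) v" "0 < v"
    and g: "right_continuous g" and w: "locally_finite_variation q g"
    and f: "antiderivative f g"
  shows "convergent (\<lambda>n. riemann_sum (\<pi> n) S g t)"
    and "has_young_integral_line p q l g (f (S t) - f (S 0) - lim (\<lambda>n. riemann_sum (\<pi> n) S g t))"
proof -
  obtain a0 b0 where ab0: "a0 < b0" "S ` {0..t} \<subseteq> {a0<..<b0}"
    using continuous_image_in_interval[OF S] by metis
  have formula: "(\<lambda>n. riemann_sum (\<pi> n) S g t) \<longlonglongrightarrow> lim (\<lambda>n. riemann_sum (\<pi> n) S g t) \<and>
      (\<forall>m u. (\<forall>n. partition_of_interval A B (m n) (u n)) \<longrightarrow> (\<lambda>n. mesh (m n) (u n)) \<longlonglongrightarrow> 0 \<longrightarrow>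
        (\<lambda>n. young_sum l g (m n) (u n)) \<longlonglongrightarrow> f (S t) - f (S 0) - lim (\<lambda>n. riemann_sum (\<pi> n) S g t))"
    if AB: "A < B" "S ` {0..t} \<subseteq> {A<..<B}" for A B
  proof -
    have "p_variation_on {A..B} q g < \<infinity>" using w by (simp add: locally_finite_variation_def)
    then obtain W where W: "0 < W" "variation_bounded {A..B} q g W"
      using variation_bounded_of_finite pq(2) by metis
    obtain I where I: "(\<lambda>n. riemann_sum (\<pi> n) S g t) \<longlonglongrightarrow> f (S t) - f (S 0) - I"
      "\<And>m u. \<lbrakk>\<And>n. partition_of_interval A B (m n) (u n); (\<lambda>n. mesh (m n) (u n)) \<longlonglongrightarrow> 0\<rbrakk>
        \<Longrightarrow> (\<lambda>n. young_sum l g (m n) (u n)) \<longlonglongrightarrow> I"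
      using local_time_formula_bounded_range[OF pq \<pi> t l AB(2,1) v g W(2,1) f] by blast
    have "lim (\<lambda>n. riemann_sum (\<pi> n) S g t) = f (S t) - f (S 0) - I" using I(1) by (rule limI)
    then show ?thesis using I by simp
  qed
  show "convergent (\<lambda>n. riemann_sum (\<pi> n) S g t)"
    using formula[OF ab0] convergentI by blast
  have lv: "variation_bounded UNIV p l v"
    using v(1) tendsto_uniform_limitI[OF l] pq(1) by (rule variation_bounded_limit) simp
  have "{x. l x \<noteq> 0} \<subseteq> {a0<..<b0}" using limit_support[OF \<pi> t l ab0(2)] by blast
  then have "bounded {x. l x \<noteq> 0}" by (rule bounded_subset[rotated]) simp
  then have cpt: "compact (closure {x. l x \<noteq> 0})" by simp
  have "has_young_integral p q l g a b (f (S t) - f (S 0) - lim (\<lambda>n. riemann_sum (\<pi> n) S g t))"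
    if ab: "a < b" and supp: "closure {x. l x \<noteq> 0} \<subseteq> {a<..<b}" for a b
    unfolding has_young_integral_def
  proof (intro conjI allI impI ballI)
    show "a < b" by fact
    have "variation_bounded {a..b} p l v" using lv by (rule variation_bounded_weaken) auto
    then show "p_variation_on {a..b} p l < \<infinity>"
      using p_variation_if_variation_bounded pq(1) ennreal_less_top le_less_trans infinity_ennreal_def by metis
    show "p_variation_on {a..b} q g < \<infinity>" using w by (simp add: locally_finite_variation_def)
    show "continuous (at x within {a..b}) l \<or> continuous (at x within {a..b}) g" for x
      using cont continuous_on_eq_continuous_within continuous_within_subset by (metis UNIV_I subset_UNIV)
  next
    fix m u
    assume D: "(\<forall>n. partition_of_interval a b (m n) (u n)) \<and> (\<lambda>n. mesh (m n) (u n)) \<longlonglongrightarrow> 0"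
    \<comment> \<open>The margin of \<open>1\<close> makes both extensions of the grid proper, and the range of the path
      stays in the interior.\<close>
    define A where "A = min a a0 - 1"
    define B where "B = max b b0 + 1"
    have AB: "A < a" "b < B" "A < B" "S ` {0..t} \<subseteq> {A<..<B}"
      using ab ab0 by (auto simp: A_def B_def image_subset_iff) 
    have "l x = 0" if "x \<notin> {a<..<b}" for x
      using that supp closure_subset[of "{x. l x \<noteq> 0}"] by blast
    then obtain m' u' where ext: "\<And>n. partition_of_interval A B (m' n) (u' n)"
        "(\<lambda>n. mesh (m' n) (u' n)) \<longlonglongrightarrow> 0"
        "\<And>n. young_sum l g (m' n) (u' n) = young_sum l g (m n) (u n)"
      using partition_extension[of a b m u A B l g] D AB ab by blast
    have "(\<lambda>n. young_sum l g (m' n) (u' n)) \<longlonglongrightarrow>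
        f (S t) - f (S 0) - lim (\<lambda>n. riemann_sum (\<pi> n) S g t)"
      using formula[OF AB(3,4)] ext(1,2) by blast
    then show "(\<lambda>n. \<Sum>j<m n. l (u n j) * (g (u n (Suc j)) - g (u n j)))
      \<longlonglongrightarrow> f (S t) - f (S 0) - lim (\<lambda>n. riemann_sum (\<pi> n) S g t)"
      unfolding ext(3) by (simp add: young_sum_def)
  qed
  with cpt show "has_young_integral_line p q l g
      (f (S t) - f (S 0) - lim (\<lambda>n. riemann_sum (\<pi> n) S g t))"
    by (simp add: has_young_integral_line_def)
qed

section \<open>The path integral as a bounded operator\<close>

lemma paths_cp_variation:
  assumes "S \<in> paths_cp p \<pi>" "1 \<le> p"
  obtains v where "0 < v"
    "\<And>n t. t \<in> {0..T} \<Longrightarrow> variation_bounded UNIV p (discrete_local_time (\<pi> n) S t) v"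
proof -
  \<comment> \<open>The hypothesis on the paths concerns positive times only; a larger positive time covers \<open>T \<le> 0\<close>.\<close>
  define T' where "T' = \<bar>T\<bar> + 1"
  define X where "X = (SUP n. SUP t\<in>{0..T'}. p_variation_on UNIV p (discrete_local_time (\<pi> n) S t))"
  have "X < \<infinity>" using assms(1) unfolding paths_cp_def X_def T'_def by auto
  then obtain c where c: "0 \<le> c" "X = ennreal c" by (cases X) auto
  show ?thesis
  proof
    show "0 < c powr p + 1" by (simp add: add_nonneg_pos)
    fix n t assume t: "t \<in> {0..T}"
    have "p_variation_on UNIV p (discrete_local_time (\<pi> n) S t)
        \<le> (SUP t\<in>{0..T'}. p_variation_on UNIV p (discrete_local_time (\<pi> n) S t))"
      using t by (intro SUP_upper) (auto simp: T'_def)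
    also have "\<dots> \<le> X" unfolding X_def by (rule SUP_upper) simp
    finally have "variation_bounded UNIV p (discrete_local_time (\<pi> n) S t) (c powr p)"
      using c assms(2) by (intro variation_bounded_if_p_variation) auto
    then show "variation_bounded UNIV p (discrete_local_time (\<pi> n) S t) (c powr p + 1)"
      by (rule variation_bounded_weaken) auto
  qed
qed

lemma locally_finite_variation_bounded:
  assumes "locally_finite_variation q g" "1 \<le> q"
  shows "\<exists>G. \<forall>x\<in>{a..b}. \<bar>g x\<bar> \<le> G"
  using assms variation_bounded_of_finite variation_bounded_imp_bounded
  unfolding locally_finite_variation_def by metis

lemma V_space_bounds:
  assumes g: "g \<in> V_space q" and q: "1 \<le> q"
  obtains c where "0 \<le> c" "V_norm q g = ennreal c" "\<And>x. \<bar>g x\<bar> \<le> c"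
    "variation_bounded UNIV q g (c powr q)" "right_continuous g" "locally_finite_variation q g"
proof -
  have "V_norm q g < \<infinity>" and rc: "right_continuous g" using g by (auto simp: V_space_def)
  then obtain c where c: "0 \<le> c" "V_norm q g = ennreal c" by (cases "V_norm q g") auto
  have le: "p_variation_on UNIV q g \<le> ennreal c" "sup_norm_on UNIV g \<le> ennreal c"
    unfolding c(2)[symmetric] V_norm_def by auto
  have "\<bar>g x\<bar> \<le> c" for x
  proof -
    have "ennreal \<bar>g x\<bar> \<le> sup_norm_on UNIV g" unfolding sup_norm_on_def by (rule SUP_upper) simp
    then have "ennreal \<bar>g x\<bar> \<le> ennreal c" using le(2) by (rule order_trans)
    then show ?thesis using c(1) by simp
  qed
  moreover have var: "variation_bounded UNIV q g (c powr q)"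
    using le(1) c(1) q by (rule variation_bounded_if_p_variation)
  moreover have "locally_finite_variation q g"
    unfolding locally_finite_variation_def
  proof (intro allI)
    fix a b
    have "variation_bounded {a..b} q g (c powr q)" using var by (rule variation_bounded_weaken) auto
    then show "p_variation_on {a..b} q g < \<infinity>"
      using p_variation_if_variation_bounded q ennreal_less_top le_less_trans infinity_ennreal_def by metis
  qed
  ultimately show ?thesis using that c rc by blast
qed

lemma riemann_sum_add:
  assumes "time_partition \<tau>" "0 \<le> t"
  shows "riemann_sum \<tau> S (\<lambda>u. g u + h u) t = riemann_sum \<tau> S g t + riemann_sum \<tau> S h t"
proof -
  obtain N s where grid: "time_grid \<tau> t N s" using time_partition_grid[OF assms] by blast
  show ?thesis unfolding time_gridD(5)[OF grid] by (simp add: sum.distrib distrib_right)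
qed

lemma riemann_sum_cmult:
  assumes "time_partition \<tau>" "0 \<le> t"
  shows "riemann_sum \<tau> S (\<lambda>u. c * g u) t = c * riemann_sum \<tau> S g t"
proof -
  obtain N s where grid: "time_grid \<tau> t N s" using time_partition_grid[OF assms] by blast
  show ?thesis unfolding time_gridD(5)[OF grid] by (simp add: sum_distrib_left mult.assoc)
qed

lemma young_sum_tendsto_path_integral:
  assumes pq: "1 \<le> p" "1 \<le> q" "1 < 1 / p + 1 / q"
    and \<pi>: "\<And>n. time_partition (\<pi> n)" and t: "0 \<le> t"
    and l: "uniform_limit UNIV (\<lambda>n. discrete_local_time (\<pi> n) S t) l sequentially"
    and S: "S ` {0..t} \<subseteq> {a<..<b}" and ab: "a < b"
    and v: "\<And>n. variation_bounded UNIV p (discrete_local_time (\<pi> n) S t) v" "0 < v"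
    and g: "right_continuous g" and w: "variation_bounded {a..b} q g w" "0 < w"
    and f: "antiderivative f g"
  shows "(\<lambda>k. young_sum l g (Suc k) (\<lambda>j. a + real j * ((b - a) / Suc k)))
    \<longlonglongrightarrow> f (S t) - f (S 0) - path_integral \<pi> S g t"
proof -
  obtain I where I: "(\<lambda>n. riemann_sum (\<pi> n) S g t) \<longlonglongrightarrow> f (S t) - f (S 0) - I"
      "\<And>m u. \<lbrakk>\<And>n. partition_of_interval a b (m n) (u n); (\<lambda>n. mesh (m n) (u n)) \<longlonglongrightarrow> 0\<rbrakk>
        \<Longrightarrow> (\<lambda>n. young_sum l g (m n) (u n)) \<longlonglongrightarrow> I"
    using local_time_formula_bounded_range[OF assms] by blast
  have "path_integral \<pi> S g t = f (S t) - f (S 0) - I"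
    unfolding path_integral_def using I(1) by (rule limI)
  moreover have "(\<lambda>k. young_sum l g (Suc k) (\<lambda>j. a + real j * ((b - a) / Suc k))) \<longlonglongrightarrow> I"
  proof (rule I(2))
    show "partition_of_interval a b (Suc k) (\<lambda>j. a + real j * ((b - a) / Suc k))" for k
      by (rule uniform_partition[OF ab])
    show "(\<lambda>k. mesh (Suc k) (\<lambda>j. a + real j * ((b - a) / Suc k))) \<longlonglongrightarrow> 0"
      unfolding uniform_partition(2)[OF ab] by (rule uniform_mesh_tendsto)
  qed
  ultimately show ?thesis by simp
qed

text \<open>
  The increment of \<open>f\<close> contributes at most \<open>(b - a) c\<close>, and the Young integral at most the bound
  that holds for each of its approximating sums.
\<close>

lemma path_integral_bound:
  assumes pq: "1 \<le> p" "1 \<le> q" "1 < 1 / p + 1 / q"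
    and \<pi>: "\<And>n. time_partition (\<pi> n)" and t: "0 \<le> t"
    and l: "uniform_limit UNIV (\<lambda>n. discrete_local_time (\<pi> n) S t) l sequentially"
    and S: "S ` {0..t} \<subseteq> {a<..<b}" and ab: "a < b"
    and v: "\<And>n. variation_bounded UNIV p (discrete_local_time (\<pi> n) S t) v" "0 < v"
    and g: "right_continuous g" and w: "variation_bounded {a..b} q g (c powr q)" "0 < c"
    and sup: "\<And>x. \<bar>g x\<bar> \<le> c"
  shows "\<bar>path_integral \<pi> S g t\<bar> \<le> ((b - a) + young_const (1 / p + 1 / q) * v powr (1 / p)) * c"
proof -
  obtain f where f: "antiderivative f g"
    using antiderivative_exists[OF g] sup by metis
  have w': "0 < c powr q" using w(2) by simp
  let ?Y = "\<lambda>k. young_sum l g (Suc k) (\<lambda>j. a + real j * ((b - a) / Suc k))"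
  have lim: "?Y \<longlonglongrightarrow> f (S t) - f (S 0) - path_integral \<pi> S g t"
    by (rule young_sum_tendsto_path_integral[OF pq \<pi> t l S ab v g w(1) w' f])
  have lv: "variation_bounded UNIV p l v"
    using v(1) tendsto_uniform_limitI[OF l] pq(1) by (rule variation_bounded_limit) simp
  have la: "l a = 0" by (rule limit_support[OF \<pi> t l S]) simp
  have "\<bar>?Y k\<bar> \<le> young_const (1 / p + 1 / q) * (v powr (1 / p) * (c powr q) powr (1 / q))" for k
  proof (rule young_sum_bound[OF _ w(1) v(2) w' pq])
    note D = uniform_partition(1)[OF ab, of k]
    show "variation_bounded {a..b} p l v" using lv by (rule variation_bounded_weaken) auto
    show "strict_mono_on {..Suc k} (\<lambda>j. a + real j * ((b - a) / Suc k))"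
      using D unfolding partition_of_interval_def by blast
    show "(\<lambda>j. a + real j * ((b - a) / Suc k)) ` {..Suc k} \<subseteq> {a..b}"
      using partition_mem[OF D] by blast
    show "l (a + real 0 * ((b - a) / Suc k)) = 0" using la by simp
  qed
  then have Y: "\<bar>?Y k\<bar> \<le> young_const (1 / p + 1 / q) * (v powr (1 / p) * c)" for k
    using pq(2) w(2) by (simp add: powr_powr)
  have "\<bar>f (S t) - f (S 0) - path_integral \<pi> S g t\<bar> \<le> young_const (1 / p + 1 / q) * (v powr (1 / p) * c)"
    by (rule LIMSEQ_le_const2[OF tendsto_rabs[OF lim]]) (use Y in blast)
  moreover have St: "S t \<in> {a<..<b}" "S 0 \<in> {a<..<b}" using S t by (auto simp: image_subset_iff)
  have "\<bar>f (S t) - f (S 0)\<bar> \<le> c * \<bar>S t - S 0\<bar>"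
    using antiderivative_lipschitz[OF f, of a b c "S 0" "S t"] sup St by auto
  moreover have "c * \<bar>S t - S 0\<bar> \<le> c * (b - a)"
    using St w(2) by (intro mult_left_mono) auto
  ultimately have "\<bar>path_integral \<pi> S g t\<bar> \<le> c * (b - a) + young_const (1 / p + 1 / q) * (v powr (1 / p) * c)"
    by linarith
  then show ?thesis by (simp add: algebra_simps)
qed

text \<open>
  By joint continuity, \<open>L s\<close> and \<open>L t\<close> are uniformly close on a compact interval that contains the
  range of the path when \<open>s\<close> is close to \<open>t\<close>, while the variation of their difference stays bounded. Hence their Young integrals are
  close by the same estimate that made the limits interchangeable.
\<close>

lemma path_integral_continuous:
  assumes pq: "1 \<le> p" "1 \<le> q" "1 < 1 / p + 1 / q"
    and \<pi>: "\<And>n. time_partition (\<pi> n)"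
    and l: "\<And>t. t \<in> {0..T} \<Longrightarrow> uniform_limit UNIV (\<lambda>n. discrete_local_time (\<pi> n) S t) (L t) sequentially"
    and L: "continuous_on ({0..} \<times> UNIV) (\<lambda>(t, u). L t u)"
    and cont: "continuous_on {0..} S" and S: "S ` {0..T} \<subseteq> {a<..<b}" and ab: "a < b"
    and v: "\<And>n t. t \<in> {0..T} \<Longrightarrow> variation_bounded UNIV p (discrete_local_time (\<pi> n) S t) v" "0 < v"
    and g: "right_continuous g" and w: "variation_bounded {a..b} q g w" "0 < w"
    and sup: "\<And>x. \<bar>g x\<bar> \<le> c"
  shows "continuous_on {0..T} (path_integral \<pi> S g)"
proof -
  obtain f where f: "antiderivative f g"
    using antiderivative_exists[OF g] sup by metis
  let ?Y = "\<lambda>t k. young_sum (L t) g (Suc k) (\<lambda>j. a + real j * ((b - a) / Suc k))"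
  define I where "I = (\<lambda>t. f (S t) - f (S 0) - path_integral \<pi> S g t)"
  have sub: "S ` {0..t} \<subseteq> {a<..<b}" if "t \<in> {0..T}" for t
    using S that by (auto simp: image_subset_iff)
  have lim: "?Y t \<longlonglongrightarrow> I t" if "t \<in> {0..T}" for t
    unfolding I_def using that
    by (intro young_sum_tendsto_path_integral[OF pq \<pi> _ l sub ab v g w f]) auto
  have lv: "variation_bounded UNIV p (L t) v" if "t \<in> {0..T}" for t
    using v(1)[OF that] tendsto_uniform_limitI[OF l[OF that]] pq(1)
    by (rule variation_bounded_limit) simp
  have La: "L t a = 0" if "t \<in> {0..T}" for t
    using that by (intro limit_support[OF \<pi> _ l sub]) auto
  have "continuous_on {0..T} I"
    unfolding continuous_on_iff
  proof (intro ballI allI impI)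
    fix t \<epsilon> :: real assume t: "t \<in> {0..T}" and "0 < \<epsilon>"
    have v': "0 < 2 powr p * (v + v)" using v(2) by simp
    have "0 < \<epsilon> / 2" using \<open>0 < \<epsilon>\<close> by simp
    then obtain \<delta> where \<delta>: "0 < \<delta>" and small: "\<And>h m u. \<lbrakk>variation_bounded {a..b} p h (2 powr p * (v + v));
        \<And>x. x \<in> {a..b} \<Longrightarrow> \<bar>h x\<bar> \<le> \<delta>; strict_mono_on {..m::nat} u; u ` {..m} \<subseteq> {a..b}; h (u 0) = 0\<rbrakk>
        \<Longrightarrow> \<bar>young_sum h g m u\<bar> \<le> \<epsilon> / 2"
      using young_sum_small[OF w(1) v' w(2) pq] by metis
    have "uniformly_continuous_on ({0..T} \<times> {a..b}) (\<lambda>(t, u). L t u)"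
      by (intro compact_uniformly_continuous continuous_on_subset[OF L] compact_Times) auto
    then obtain d where d: "0 < d" and uc: "\<And>z z'. z \<in> {0..T} \<times> {a..b} \<Longrightarrow> z' \<in> {0..T} \<times> {a..b} \<Longrightarrow>
        dist z' z < d \<Longrightarrow> dist (case z' of (t, u) \<Rightarrow> L t u) (case z of (t, u) \<Rightarrow> L t u) < \<delta>"
      using \<delta> unfolding uniformly_continuous_on_def by metis
    show "\<exists>d>0. \<forall>s\<in>{0..T}. dist s t < d \<longrightarrow> dist (I s) (I t) < \<epsilon>"
    proof (intro exI[of _ d] conjI ballI impI d)
      fix s assume s: "s \<in> {0..T}" and st: "dist s t < d"
      have "\<bar>?Y s k - ?Y t k\<bar> \<le> \<epsilon> / 2" for k
        unfolding young_sum_diff[symmetric]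
      proof (rule small)
        note D = uniform_partition(1)[OF ab, of k]
        show "variation_bounded {a..b} p (\<lambda>x. L s x - L t x) (2 powr p * (v + v))"
          using variation_bounded_diff[OF lv[OF s] lv[OF t] pq(1)] by (rule variation_bounded_weaken) auto
        show "\<bar>L s x - L t x\<bar> \<le> \<delta>" if "x \<in> {a..b}" for x
          using uc[of "(t, x)" "(s, x)"] s t st that by (simp add: dist_Pair_Pair dist_real_def)
        show "strict_mono_on {..Suc k} (\<lambda>j. a + real j * ((b - a) / Suc k))"
          using D unfolding partition_of_interval_def by blast
        show "(\<lambda>j. a + real j * ((b - a) / Suc k)) ` {..Suc k} \<subseteq> {a..b}"
          using partition_mem[OF D] by blast
        show "L s (a + real 0 * ((b - a) / Suc k)) - L t (a + real 0 * ((b - a) / Suc k)) = 0"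
          using La s t by simp
      qed
      moreover have "(\<lambda>k. \<bar>?Y s k - ?Y t k\<bar>) \<longlonglongrightarrow> \<bar>I s - I t\<bar>"
        by (intro tendsto_rabs tendsto_diff lim s t)
      ultimately have "\<bar>I s - I t\<bar> \<le> \<epsilon> / 2" by (intro LIMSEQ_le_const2) auto
      then show "dist (I s) (I t) < \<epsilon>" using \<open>0 < \<epsilon>\<close> by (simp add: dist_real_def)
    qed
  qed
  moreover have "continuous_on {0..T} (\<lambda>t. f (S t))"
  proof (rule continuous_on_compose2[where g = f and f = S and t = UNIV])
    have "(\<bar>c\<bar>)-lipschitz_on UNIV f"
    proof (rule lipschitz_onI)
      fix x y
      have "\<bar>f x - f y\<bar> \<le> \<bar>c\<bar> * \<bar>x - y\<bar>"
      proof (rule antiderivative_lipschitz[OF f, of "min x y" "max x y"])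
        show "\<bar>g z\<bar> \<le> \<bar>c\<bar>" for z using sup[of z] by simp
      qed auto
      then show "dist (f x) (f y) \<le> \<bar>c\<bar> * dist x y" by (simp add: dist_real_def)
    qed simp
    then show "continuous_on UNIV f" by (rule lipschitz_on_continuous_on)
    show "continuous_on {0..T} S" using cont by (rule continuous_on_subset) auto
  qed simp
  ultimately have "continuous_on {0..T} (\<lambda>t. f (S t) - f (S 0) - I t)"
    by (intro continuous_intros)
  then show ?thesis by (simp add: I_def)
qed

theorem theorem2p8:
  fixes p q :: real
    and \<pi> :: "nat \<Rightarrow> nat \<Rightarrow> ereal"
    and S :: "real \<Rightarrow> real"
    and L :: "real \<Rightarrow> real \<Rightarrow> real"
    and f f' :: "real \<Rightarrow> real"
  assumes "p \<ge> 1" and "q \<ge> 1" and "1 / p + 1 / q > 1"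
    and "\<And>n. time_partition (\<pi> n)"
    and "S \<in> paths_cp p \<pi>"
    and "continuous_local_time \<pi> S L"
    and "absolutely_continuous_with_density f f'"
    and "right_continuous f'"
    and "locally_finite_variation q f'"
  shows "(\<forall>t\<ge>0. convergent (\<lambda>n. riemann_sum (\<pi> n) S f' t) \<and>
            (\<exists>I. has_young_integral_line p q (L t) f' I \<and>
                 f (S t) = f (S 0) + path_integral \<pi> S f' t + I)) \<and>
         (\<forall>g. right_continuous g \<and> locally_finite_variation q g \<longrightarrow>
            (\<forall>t\<ge>0. convergent (\<lambda>n. riemann_sum (\<pi> n) S g t))) \<and>
         (\<forall>T>0. bounded_linear_V_C q T (path_integral \<pi> S))"
proof -
  note pq = assms(1-3) and \<pi> = assms(4)
  have S: "continuous_on {0..} S"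
    using assms(5) by (auto simp: paths_cp_def paths_c_def paths_L2_def)
  have l: "uniform_limit UNIV (\<lambda>n. discrete_local_time (\<pi> n) S t) (L t) sequentially"
    and cont: "continuous_on UNIV (L t)" if "0 \<le> t" for t
    using assms(6) that by (auto simp: continuous_local_time_def)
  have L: "continuous_on ({0..} \<times> UNIV) (\<lambda>(t, u). L t u)"
    using assms(6) by (simp add: continuous_local_time_def)
  have line: "convergent (\<lambda>n. riemann_sum (\<pi> n) S g t)"
      "has_young_integral_line p q (L t) g (F (S t) - F (S 0) - path_integral \<pi> S g t)"
    if "0 \<le> t" "right_continuous g" "locally_finite_variation q g" "antiderivative F g" for t g F
  proof -
    obtain v where v: "0 < v"
      "\<And>n s. s \<in> {0..t} \<Longrightarrow> variation_bounded UNIV p (discrete_local_time (\<pi> n) S s) v"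
      using paths_cp_variation[OF assms(5) pq(1)] by metis
    have tt: "t \<in> {0..t}" using that(1) by simp
    note young_integral_line_formula[OF pq \<pi> that(1) l[OF that(1)] cont[OF that(1)] S
      v(2)[OF tt] v(1) that(2-4)]
    then show "convergent (\<lambda>n. riemann_sum (\<pi> n) S g t)"
      "has_young_integral_line p q (L t) g (F (S t) - F (S 0) - path_integral \<pi> S g t)"
      by (simp_all add: path_integral_def)
  qed
  have conv: "convergent (\<lambda>n. riemann_sum (\<pi> n) S g t)"
    if g: "right_continuous g" "locally_finite_variation q g" and t: "0 \<le> t" for g t
  proof -
    obtain F where "antiderivative F g"
      using antiderivative_exists[OF g(1)] locally_finite_variation_bounded[OF g(2) pq(2)] by metis
    then show ?thesis using line(1)[OF t g] by blast
  qed
  have "antiderivative f f'"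
    using assms(7) by (simp add: absolutely_continuous_with_density_def antiderivative_def)
  note formula = line[OF _ assms(8,9) this]
  have "bounded_linear_V_C q T (path_integral \<pi> S)" if "0 < T" for T
  proof -
    obtain a b where ab: "a < b" "S ` {0..T} \<subseteq> {a<..<b}"
      using continuous_image_in_interval[OF S] by metis
    obtain v where v: "0 < v"
      "\<And>n t. t \<in> {0..T} \<Longrightarrow> variation_bounded UNIV p (discrete_local_time (\<pi> n) S t) v"
      using paths_cp_variation[OF assms(5) pq(1)] by metis
    define C where "C = (b - a) + young_const (1 / p + 1 / q) * v powr (1 / p)"
    have C: "0 \<le> C" using ab young_const_nonneg[OF pq(3)] by (simp add: C_def)
    have lim: "(\<lambda>n. riemann_sum (\<pi> n) S g t) \<longlonglongrightarrow> path_integral \<pi> S g t"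
      if "g \<in> V_space q" "t \<in> {0..T}" for g t
    proof -
      have "right_continuous g" "locally_finite_variation q g"
        using V_space_bounds[OF that(1) pq(2)] by metis+
      then show ?thesis using conv[of g t] that(2) by (simp add: path_integral_def convergent_LIMSEQ_iff)
    qed
    show ?thesis
      unfolding bounded_linear_V_C_def
    proof (intro conjI ballI allI)
      fix g assume "g \<in> V_space q"
      then obtain c where c: "0 \<le> c" "\<And>x. \<bar>g x\<bar> \<le> c"
        "variation_bounded UNIV q g (c powr q)" "right_continuous g"
        using V_space_bounds pq(2) by metis
      \<comment> \<open>Adding \<open>1\<close> makes the bound positive also when \<open>g\<close> has no variation.\<close>
      have w: "variation_bounded {a..b} q g (c powr q + 1)"
        using c(3) by (rule variation_bounded_weaken) auto
      have "0 < c powr q + 1" by (simp add: add_nonneg_pos)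
      then show "continuous_on {0..T} (path_integral \<pi> S g)"
        using path_integral_continuous[OF pq \<pi> l L S ab(2,1) v(2,1) c(4) w _ c(2)] by auto
    next
      fix g h t assume "g \<in> V_space q" "h \<in> V_space q" and t: "t \<in> {0..T}"
      then have "(\<lambda>n. riemann_sum (\<pi> n) S g t + riemann_sum (\<pi> n) S h t)
          \<longlonglongrightarrow> path_integral \<pi> S g t + path_integral \<pi> S h t"
        by (intro tendsto_add lim)
      then show "path_integral \<pi> S (\<lambda>u. g u + h u) t = path_integral \<pi> S g t + path_integral \<pi> S h t"
        using riemann_sum_add[OF \<pi>] t unfolding path_integral_def[of \<pi> S "\<lambda>u. g u + h u"]
        by (intro limI) simp
    next
      fix k g t assume "g \<in> V_space q" and t: "t \<in> {0..T}"
      then have "(\<lambda>n. k * riemann_sum (\<pi> n) S g t) \<longlonglongrightarrow> k * path_integral \<pi> S g t"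
        by (intro tendsto_mult tendsto_const lim)
      then show "path_integral \<pi> S (\<lambda>u. k * g u) t = k * path_integral \<pi> S g t"
        using riemann_sum_cmult[OF \<pi>] t unfolding path_integral_def[of \<pi> S "\<lambda>u. k * g u"]
        by (intro limI) simp
    next
      show "\<exists>C::real. \<forall>g\<in>V_space q. sup_norm_on {0..T} (path_integral \<pi> S g) \<le> ennreal C * V_norm q g"
      proof (intro exI[of _ C] ballI)
        fix g assume "g \<in> V_space q"
        then obtain c where c: "0 \<le> c" "V_norm q g = ennreal c" "\<And>x. \<bar>g x\<bar> \<le> c"
          "variation_bounded UNIV q g (c powr q)" "right_continuous g"
          using V_space_bounds pq(2) by metis
        have "\<bar>path_integral \<pi> S g t\<bar> \<le> C * c" if t: "t \<in> {0..T}" for t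
        \<comment> \<open>The inequality of Young and Loeve is stated for positive bounds; for norm zero the
          integral vanishes directly.\<close>
        proof (cases "c = 0")
          case True
          then have "g = (\<lambda>u. 0 * g u)" using c(3) by auto
          then have "riemann_sum (\<pi> n) S g t = 0" for n
            using riemann_sum_cmult[OF \<pi>, of t n S 0 g] t by simp
          then show ?thesis using True by (simp add: path_integral_def)
        next
          case False
          have t0: "0 \<le> t" and sub: "S ` {0..t} \<subseteq> {a<..<b}"
            using t ab(2) by (auto simp: image_subset_iff)
          have "variation_bounded {a..b} q g (c powr q)"
            using c(4) by (rule variation_bounded_weaken) auto
          then show ?thesis unfolding C_def
            using path_integral_bound[OF pq \<pi> t0 l[OF t0] sub ab(1) v(2)[OF t] v(1) c(5) _ _ c(3)] c(1) False
            by simp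
        qed
        then have "sup_norm_on {0..T} (path_integral \<pi> S g) \<le> ennreal (C * c)"
          unfolding sup_norm_on_def by (intro SUP_least ennreal_leI)
        then show "sup_norm_on {0..T} (path_integral \<pi> S g) \<le> ennreal C * V_norm q g"
          using c(1,2) C by (simp add: ennreal_mult)
      qed
    qed
  qed
  then show ?thesis using formula conv by (force intro: exI)
qed

end
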